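(* Let $\mu_1,\dots,\mu_r>-1$ be such that $\mu_i-\mu_j\notin\mathbb Z$ if $i\neq j$. Let $\vec n,\vec j\in\mathbb N_0^r$ be such that $0\le|\vec j|\le|\vec n|/2$, and let $\mathbf P^{\vec n}_{\vec j,\nu}$, $\nu\in\{1,2\}$, be the associated Type II multiple orthogonal polynomials on the disk. Let $\{\vec m_k: k=0,\dots,|\vec n|\}$ be a path of neighbour multi-indices such that $|\vec m_k|=k$ for $k=0,\dots,|\vec n|$, $\vec m_0=\vec 0$, $\vec m_{|\vec n|}=\vec n$, and choose $\vec m_{|\vec n|+1}=\vec n+\vec e_l$ for some $l\in\{1,\dots,r\}$. For each $\vec m_k$, let $\mathbb P_k$ be the vector of $k+1$ polynomials whose entries are $\mathbf P^{\vec m_k}_{\vec m_i,1}$ for $0\le i\le k/2$, followed by $\mathbf P^{\vec m_k}_{\vec m_i,2}$ for $0\le i<k/2$ (each list in increasing order of $i$). Then $$x\,\mathbf P^{\vec n}_{\vec j,\nu}(\mathbf x)=\mathbf c^{(|\vec n|+1)}\mathbb P_{|\vec n|+1}+\mathbf c^{(|\vec n|)}\mathbb P_{|\vec n|}+\sum_{k=|\vec n|-2|\vec j|-1}^{|\vec n|-1}\mathbf c^{(k)}\mathbb P_k,$$ $$y\,\mathbf P^{\vec n}_{\vec j,\nu}(\mathbf x)=\tilde{\mathbf c}^{(|\vec n|+1)}\mathbb P_{|\vec n|+1}+\tilde{\mathbf c}^{(|\vec n|)}\mathbb P_{|\vec n|}+\sum_{k=|\vec n|-2|\vec j|-1}^{|\vec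 n|-1}\tilde{\mathbf c}^{(k)}\mathbb P_k,$$ where the sums start with $k=0$ if $|\vec n|-2|\vec j|=0$, the products $\mathbf c^{(k)}\mathbb P_k$, $\tilde{\mathbf c}^{(k)}\mathbb P_k$ are scalar products, and the vectors $\mathbf c^{(k)},\tilde{\mathbf c}^{(k)}\in\mathbb R^{k+1}$ have entries $c^{(k)}_{i,1}$ (resp. $\tilde c^{(k)}_{i,1}$) for $0\le i\le k/2$, followed by $c^{(k)}_{i,2}$ (resp. $\tilde c^{(k)}_{i,2}$) for $0\le i<k/2$, given by $$c^{(k)}_{i,\eta}=\frac{2}{\|Y_\eta^{k-2i}\|^2}\,\langle x\,\mathbf P^{\vec n}_{\vec j,\nu},\mathbf Q^{\vec m_{k+2}}_{\vec m_{i+1},\eta}\rangle,\qquad \tilde c^{(k)}_{i,\eta}=\frac{2}{\|Y_\eta^{k-2i}\|^2}\,\langle y\,\mathbf P^{\vec n}_{\vec j,\nu},\mathbf Q^{\vec m_{k+2}}_{\vec m_{i+1},\eta}\rangle .$$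
   Context: For a multi-index $\vec v=(v_1,\dots,v_r)\in\mathbb N_0^r$, $|\vec v|=v_1+\cdots+v_r$; $\vec e_l$ is the $l$-th standard unit vector; two multi-indices are neighbours if they differ by $\pm\vec e_l$ for some $l$, and a path of neighbour multi-indices is a sequence in which consecutive elements are neighbours. $D=\{(x,y)\in\mathbb R^2:x^2+y^2\le1\}$ is the unit disk, with polar coordinates $x=\rho\cos\theta$, $y=\rho\sin\theta$, and $\mathbf x=(x,y)$; $\langle f,g\rangle=\int_Df(\mathbf x)g(\mathbf x)\,d\mathbf x$ (Lebesgue measure). Write $\vec\mu=(\mu_1,\dots,\mu_r)$, and $W_l(x,y)=w_{\mu_l}(1-x^2-y^2)^{\mu_l}$ with $w_\mu=(\mu+1)/\pi$. Type II Jacobi–Piñeiro polynomials: for $M\in\mathbb N_0$, $\vec k\in\mathbb N_0^r$, and $\omega_l(t)=t^M(1-t)^{\mu_l}$ on $[0,1]$, they are given by the Rodrigues formula $$P^{(M,\vec\mu)}_{\vec k}(t)=\Big(\tfrac1{\omega_r(t)}\tfrac{d^{k_r}}{dt^{k_r}}\omega_r(t)(1-t)^{k_r}\Big)\cdots\Big(\tfrac1{\omega_1(t)}\tfrac{d^{k_1}}{dt^{k_1}}\omega_1(t)(1-t)^{k_1}\Big)t^{|\vec k|},$$ where each factor is the operator $f\mapsto\frac1{\omega_l}\frac{d^{k_l}}{dt^{k_l}}\big[\omega_l(1-t)^{k_l}f\big]$ applied to everything on its right. This polynomial has degree $|\vec k|$ and satisfies $\int_0^1P^{(M,\vec\mu)}_{\vec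 k}(t)\,t^s\,t^M(1-t)^{\mu_l}\,dt=0$ for $0\le s\le k_l-1$, $1\le l\le r$. Type I Jacobi–Piñeiro polynomials: $(A^{(M,\vec\mu)}_{\vec k,1},\dots,A^{(M,\vec\mu)}_{\vec k,r})$ is the vector of univariate polynomials with $\deg A^{(M,\vec\mu)}_{\vec k,l}\le k_l-1$ (so the $l$-th one is $0$ if $k_l=0$) and $$\sum_{l=1}^r \int_0^1A^{(M,\vec\mu)}_{\vec k,l}(t)\,t^s\,t^{M}(1-t)^{\mu_l}\,dt=\begin{cases}0&\text{if }0\le s\le|\vec k|-2,\\1&\text{if }s=|\vec k|-1.\end{cases}$$ For $M\in\mathbb N_0$ put $Y_1^M=\rho^M\cos(M\theta)$ and $Y_2^M=\rho^M\sin(M\theta)$, with squared norms on the unit circle $\|Y_1^M\|^2=\pi(1+\delta_{M,0})$, $\|Y_2^M\|^2=\pi$. With $M=|\vec n|-2|\vec j|$ the multiple orthogonal polynomials on the disk are $$\mathbf P^{\vec n}_{\vec j,\nu}=P^{(M,\vec\mu)}_{\vec j}(\rho^2)\,Y_\nu^M,\qquad \mathbf A^{\vec n}_{\vec j,\nu,(l)}=A^{(M,\vec\mu)}_{\vec j,l}(\rho^2)\,Y_\nu^M,\quad 1\le l\le r,$$ defined for $0\le|\vec j|\le|\vec n|/2$ if $\nu=1$ and for $0\le|\vec j|<|\vec n|/2$ if $\nu=2$ (and likewise for any other multi-indices in place of $\vec n,\vec j$). They are polynomials in $(x,y)$. The Type I function is $\mathbf Q^{\vec n}_{\vec j,\nu}(\mathbf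 x)=\sum_{l=1}^r\mathbf A^{\vec n}_{\vec j,\nu,(l)}(\mathbf x)\,W_l(\mathbf x)$; by these definitions it depends on the upper multi-index only through its modulus. In the coefficient formulas with $k=|\vec n|$ and $k=|\vec n|+1$ the upper multi-index $\vec m_{k+2}$ is not among those listed in the hypotheses; only its modulus, $|\vec m_{k+2}|=k+2$, is used.
   Formalization: The Type II Jacobi–Piñeiro polynomials are the Rodrigues polynomials divided by their leading coefficient (monic), and the Type I conditions use the weights w_{μ_l} t^M (1-t)^{μ_l} instead of t^M (1-t)^{μ_l}; with the literal normalizations the coefficient formulas are false. *)

theory Defs
  imports "HOL-Analysis.Analysis"
begin

text \<open>
  Multi-indices of length \<open>r\<close> are lists \<open>v :: nat list\<close> with \<open>length v = r\<close>; the modulus of \<open>v\<close>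
  is \<open>sum_list v\<close>. Positions \<open>1, \<dots>, r\<close> are shifted to \<open>0, \<dots>, r - 1\<close>.
\<close>

definition plus_unit :: "nat list \<Rightarrow> nat \<Rightarrow> nat list" where
  "plus_unit v l = v[l := v ! l + 1]"

definition neighbours :: "nat list \<Rightarrow> nat list \<Rightarrow> bool" where
  "neighbours u v \<longleftrightarrow>
     length u = length v \<and> (\<exists>l<length u. v = plus_unit u l \<or> u = plus_unit v l)"


definition jp_weight :: "nat \<Rightarrow> real \<Rightarrow> real \<Rightarrow> real" where
  "jp_weight M \<mu> t = t ^ M * (1 - t) powr \<mu>"

definition rodrigues_op :: "nat \<Rightarrow> real \<Rightarrow> nat \<Rightarrow> (real \<Rightarrow> real) \<Rightarrow> real \<Rightarrow> real" where
  "rodrigues_op M \<mu> k f =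
     (\<lambda>t. (deriv ^^ k) (\<lambda>u. jp_weight M \<mu> u * (1 - u) ^ k * f u) t / jp_weight M \<mu> t)"

text \<open>The operator with index 0 is applied first. Only the values on \<open>{0<..<1}\<close> are meaningful.\<close>

definition rodrigues_fun :: "nat \<Rightarrow> real list \<Rightarrow> nat list \<Rightarrow> real \<Rightarrow> real" where
  "rodrigues_fun M \<mu> k =
     fold (\<lambda>l. rodrigues_op M (\<mu> ! l) (k ! l)) [0..<length \<mu>] (\<lambda>t. t ^ sum_list k)"

definition rodrigues_poly :: "nat \<Rightarrow> real list \<Rightarrow> nat list \<Rightarrow> real poly" where
  "rodrigues_poly M \<mu> k = (THE p. \<forall>t\<in>{0<..<1}. poly p t = rodrigues_fun M \<mu> k t)"

text \<open>
  Normalisation of the Type II polynomials: the Rodrigues formula yields a polynomial with leading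
  coefficient \<open>\<Prod>l<r. (- 1) ^ k\<^sub>l * pochhammer (\<mu>\<^sub>l + M + sum_list k + 1) (k\<^sub>l)\<close>. The coefficient
  formula \<open>rec_coeff\<close> below is correct only for monic polynomials, so the Rodrigues polynomial is
  divided by its leading coefficient.
\<close>

definition jp_typeII :: "nat \<Rightarrow> real list \<Rightarrow> nat list \<Rightarrow> real poly" where
  "jp_typeII M \<mu> k =
     smult (inverse (lead_coeff (rodrigues_poly M \<mu> k))) (rodrigues_poly M \<mu> k)"

definition disk_weight_const :: "real \<Rightarrow> real" where
  "disk_weight_const \<mu> = (\<mu> + 1) / pi"

text \<open>
  Normalisation of the Type I polynomials: they are taken with respect to the radial parts
  \<open>disk_weight_const \<mu>\<^sub>l * t ^ M * (1 - t) powr \<mu>\<^sub>l\<close> of the disk weights \<open>disk_weight \<mu>\<^sub>l\<close>.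
  If the constants were left out here but kept in \<open>disk_weight\<close>, then \<open>disk_Q\<close> would in general
  not be orthogonal to polynomials of lower degree, since the constants depend on \<open>l\<close>.
\<close>

definition is_jp_typeI :: "nat \<Rightarrow> real list \<Rightarrow> nat list \<Rightarrow> real poly list \<Rightarrow> bool" where
  "is_jp_typeI M \<mu> k A \<longleftrightarrow>
     length A = length \<mu> \<and>
     (\<forall>l<length \<mu>. A ! l = 0 \<or> degree (A ! l) < k ! l) \<and>
     (\<forall>s<sum_list k.
        (\<Sum>l<length \<mu>. LBINT t:{0..1}.
            poly (A ! l) t * t ^ s * (disk_weight_const (\<mu> ! l) * jp_weight M (\<mu> ! l) t))
        = (if Suc s = sum_list k then 1 else 0))"

definition jp_typeI :: "nat \<Rightarrow> real list \<Rightarrow> nat list \<Rightarrow> real poly list" where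
  "jp_typeI M \<mu> k = (THE A. is_jp_typeI M \<mu> k A)"


definition disk :: "(real \<times> real) set" where
  "disk = {(x, y). x\<^sup>2 + y\<^sup>2 \<le> 1}"

definition disk_inner :: "(real \<times> real \<Rightarrow> real) \<Rightarrow> (real \<times> real \<Rightarrow> real) \<Rightarrow> real" where
  "disk_inner f g = (LINT p:disk|lborel. f p * g p)"

definition disk_weight :: "real \<Rightarrow> real \<times> real \<Rightarrow> real" where
  "disk_weight \<mu> = (\<lambda>(x, y). disk_weight_const \<mu> * (1 - x\<^sup>2 - y\<^sup>2) powr \<mu>)"

definition Yharm :: "nat \<Rightarrow> nat \<Rightarrow> real \<times> real \<Rightarrow> real" where
  "Yharm \<nu> M = (\<lambda>(x, y).
     let \<rho> = sqrt (x\<^sup>2 + y\<^sup>2); \<theta> = Arg (Complex x y)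
     in \<rho> ^ M * (if \<nu> = 1 then cos (real M * \<theta>) else sin (real M * \<theta>)))"

definition Ynorm2 :: "nat \<Rightarrow> nat \<Rightarrow> real" where
  "Ynorm2 \<nu> M = (if \<nu> = 1 \<and> M = 0 then 2 * pi else pi)"

text \<open>
  In the next three definitions \<open>n\<close> is the upper and \<open>j\<close> the lower multi-index; they are used only
  if \<open>2 * sum_list j \<le> sum_list n\<close>, so that the subtraction is not truncated.
\<close>

definition disk_P :: "real list \<Rightarrow> nat list \<Rightarrow> nat list \<Rightarrow> nat \<Rightarrow> real \<times> real \<Rightarrow> real" where
  "disk_P \<mu> n j \<nu> = (\<lambda>(x, y). let M = sum_list n - 2 * sum_list j in
     poly (jp_typeII M \<mu> j) (x\<^sup>2 + y\<^sup>2) * Yharm \<nu> M (x, y))"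

definition disk_A ::
    "real list \<Rightarrow> nat list \<Rightarrow> nat list \<Rightarrow> nat \<Rightarrow> nat \<Rightarrow> real \<times> real \<Rightarrow> real" where
  "disk_A \<mu> n j \<nu> l = (\<lambda>(x, y). let M = sum_list n - 2 * sum_list j in
     poly (jp_typeI M \<mu> j ! l) (x\<^sup>2 + y\<^sup>2) * Yharm \<nu> M (x, y))"

definition disk_Q :: "real list \<Rightarrow> nat list \<Rightarrow> nat list \<Rightarrow> nat \<Rightarrow> real \<times> real \<Rightarrow> real" where
  "disk_Q \<mu> n j \<nu> = (\<lambda>p. \<Sum>l<length \<mu>. disk_A \<mu> n j \<nu> l p * disk_weight (\<mu> ! l) p)"


definition block_vec :: "nat \<Rightarrow> (nat \<Rightarrow> nat \<Rightarrow> 'a) \<Rightarrow> 'a list" where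
  "block_vec k f =
     map (\<lambda>i. f i 1) (filter (\<lambda>i. 2 * i \<le> k) [0..<Suc k]) @
     map (\<lambda>i. f i 2) (filter (\<lambda>i. 2 * i < k) [0..<Suc k])"

definition scalar_prod :: "real list \<Rightarrow> real list \<Rightarrow> real" where
  "scalar_prod u v = sum_list (map2 (*) u v)"

definition disk_P_vec ::
    "real list \<Rightarrow> (nat \<Rightarrow> nat list) \<Rightarrow> nat \<Rightarrow> real \<times> real \<Rightarrow> real list" where
  "disk_P_vec \<mu> m k p = block_vec k (\<lambda>i \<eta>. disk_P \<mu> (m k) (m i) \<eta> p)"

text \<open>\<open>f\<close> is the polynomial to be expanded, that is \<open>x\<close> or \<open>y\<close> times a Type II polynomial.\<close>

definition rec_coeff ::
    "real list \<Rightarrow> (nat \<Rightarrow> nat list) \<Rightarrow> (real \<times> real \<Rightarrow> real) \<Rightarrow> nat \<Rightarrow> nat \<Rightarrow> nat \<Rightarrow> real" where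
  "rec_coeff \<mu> m f k i \<eta> =
     2 / Ynorm2 \<eta> (k - 2 * i) * disk_inner f (disk_Q \<mu> (m (k + 2)) (m (i + 1)) \<eta>)"

definition rec_vec ::
    "real list \<Rightarrow> (nat \<Rightarrow> nat list) \<Rightarrow> (real \<times> real \<Rightarrow> real) \<Rightarrow> nat \<Rightarrow> real list" where
  "rec_vec \<mu> m f k = block_vec k (rec_coeff \<mu> m f k)"

end

theory Submission
  imports Defs
begin

text \<open>
  In the variable \<open>u = 1 - t\<close> one has
  \<open>d\<^sup>k/dt\<^sup>k ((1 - t) powr (\<mu> + k) * g) = (-1)\<^sup>k (1 - t) powr \<mu> * (E + \<mu> + 1) \<dots> (E + \<mu> + k) g\<close>
  with the Euler operator \<open>E = u d/du\<close>. So the Rodrigues formula applies commuting factors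
  \<open>E + \<mu>\<^sub>l + i\<close> to \<open>t\<close> to the power \<open>M + |k|\<close>. Under the functional \<open>f \<mapsto> \<integral> f (1 - t) powr \<mu> dt\<close> with
  \<open>f = u\<^sup>\<kappa> (E + a) g\<close> and \<open>g\<close> vanishing at \<open>t = 0\<close>, such a factor becomes the scalar \<open>a - \<mu> - 1 - \<kappa>\<close>. This gives
  the orthogonality relations, and it shows that the first moment beyond them does not vanish, because
  the differences of the \<open>\<mu>\<^sub>l\<close> are not integers. From the latter, the linear system of the Type I
  polynomials is uniquely solvable, by induction on \<open>|k|\<close>.
  Along an increasing path the two families are biorthogonal, so every polynomial expands in the
  monic Type II polynomials with the Type I pairings as coefficients.

  Multiplication by \<open>x\<close> or \<open>y\<close> turns the harmonic of degree \<open>M\<close> into harmonics of degree \<open>M + 1\<close> and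
  \<open>M - 1\<close> with radial factors, and each radial factor is expanded as above. The inner products on the
  disk reduce to radial ones by rotation invariance.
\<close>

section \<open>Euler operators and Jacobi integrals\<close>

definition jacobi_int :: "real \<Rightarrow> real poly \<Rightarrow> real" where
  "jacobi_int \<mu> p = (LBINT t:{0..1}. poly p t * (1 - t) powr \<mu>)"

lemma powr_one_minus_integrable:
  assumes "\<mu> > (-1::real)"
  shows "set_integrable lborel {0..1} (\<lambda>t. (1 - t) powr \<mu>)"
proof -
  have "((\<lambda>t. (1 - t) powr \<mu>) has_integral
      (- ((1 - 1) powr (\<mu> + 1)) / (\<mu> + 1) - - ((1 - 0) powr (\<mu> + 1)) / (\<mu> + 1))) {0..1}"
  proof (rule fundamental_theorem_of_calculus_interior)
    show "continuous_on {0..1} (\<lambda>t. - ((1 - t) powr (\<mu> + 1)) / (\<mu> + 1))"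
      using assms by (intro continuous_intros continuous_on_powr') auto
    show "((\<lambda>t. - ((1 - t) powr (\<mu> + 1)) / (\<mu> + 1)) has_vector_derivative (1 - t) powr \<mu>) (at t)"
      if "t \<in> {0<..<1}" for t
      using assms that
      by (auto intro!: derivative_eq_intros simp flip: has_real_derivative_iff_has_vector_derivative)
  qed auto
  \<comment> \<open>The fundamental theorem yields a gauge integral. It is absolute because the
    integrand is nonnegative, and Borel measurability carries it from the completed measure to
    \<open>lborel\<close>.\<close>
  then have "(\<lambda>t. (1 - t) powr \<mu>) absolutely_integrable_on {0..1}"
    by (intro nonnegative_absolutely_integrable_1) (auto simp: has_integral_integrable)
  then show ?thesis
    unfolding set_integrable_def by (subst (asm) integrable_completion) auto
qed

lemma poly_mult_set_integrable:
  assumes "set_integrable lborel {0..1} (g :: real \<Rightarrow> real)"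
  shows "set_integrable lborel {0..1} (\<lambda>t. poly p t * g t)"
proof -
  have "compact (poly p ` {0..1})"
    by (intro compact_continuous_image continuous_intros) auto
  then have "bounded (poly p ` {0..1})" by (rule compact_imp_bounded)
  then obtain B where B: "\<And>t. t \<in> {0..1} \<Longrightarrow> \<bar>poly p t\<bar> \<le> B"
    unfolding bounded_iff by (metis image_eqI real_norm_def)
  have m: "poly p \<in> borel_measurable borel"
    by (intro borel_measurable_continuous_onI continuous_intros)
  have mg: "(\<lambda>t. indicat_real {0..1} t * g t) \<in> borel_measurable lborel"
    using assms unfolding set_integrable_def by (simp add: borel_measurable_integrable)
  have "integrable lborel (\<lambda>t. B * (indicat_real {0..1} t * g t))"
    using assms unfolding set_integrable_def by simp
  then show ?thesis unfolding set_integrable_def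
  proof (rule Bochner_Integration.integrable_bound)
    have "(\<lambda>t. poly p t * (indicat_real {0..1} t * g t)) \<in> borel_measurable lborel"
      using m mg by measurable
    then show "(\<lambda>t. indicat_real {0..1} t *\<^sub>R (poly p t * g t)) \<in> borel_measurable lborel"
      by (simp add: mult_ac)
    have "\<bar>poly p t\<bar> * \<bar>g t\<bar> \<le> \<bar>B\<bar> * \<bar>g t\<bar>" if "t \<in> {0..1}" for t
      by (intro mult_right_mono order_trans[OF B[OF that] abs_ge_self]) auto
    then show "AE t in lborel. norm (indicat_real {0..1} t *\<^sub>R (poly p t * g t)) \<le>
        norm (B * (indicat_real {0..1} t * g t))"
      by (auto simp: indicator_def abs_mult)
  qed
qed

lemma jacobi_integrable:
  assumes "\<mu> > (-1::real)"
  shows "set_integrable lborel {0..1} (\<lambda>t. poly p t * (1 - t) powr \<mu>)"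
  by (rule poly_mult_set_integrable[OF powr_one_minus_integrable[OF assms]])

lemma jacobi_int_add:
  assumes "\<mu> > -1"
  shows "jacobi_int \<mu> (p + q) = jacobi_int \<mu> p + jacobi_int \<mu> q"
  using set_integral_add(2)[OF jacobi_integrable[OF assms] jacobi_integrable[OF assms], of p q]
  by (simp add: jacobi_int_def algebra_simps)

lemma jacobi_int_smult: "jacobi_int \<mu> (smult c p) = c * jacobi_int \<mu> p"
  by (simp add: jacobi_int_def mult.assoc)

lemma jacobi_int_0 [simp]: "jacobi_int \<mu> 0 = 0"
  by (simp add: jacobi_int_def)

lemma jacobi_int_diff:
  assumes "\<mu> > -1"
  shows "jacobi_int \<mu> (p - q) = jacobi_int \<mu> p - jacobi_int \<mu> q"
  using jacobi_int_add[OF assms, of p "smult (-1) q"] jacobi_int_smult[of \<mu> "-1" q] by simp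

lemma jacobi_int_sum:
  assumes "\<mu> > -1"
  shows "jacobi_int \<mu> (\<Sum>i\<in>I. f i) = (\<Sum>i\<in>I. jacobi_int \<mu> (f i))"
  by (induction I rule: infinite_finite_induct) (auto simp: jacobi_int_add[OF assms])

lemma jacobi_int_shift: "jacobi_int \<mu> ([:1, -1:] ^ k * p) = jacobi_int (\<mu> + real k) p"
  unfolding jacobi_int_def
proof (rule set_lebesgue_integral_cong_AE)
  \<comment> \<open>The endpoint 1 is left out because turning a power into \<open>powr\<close>
    requires a positive base.\<close>
  show "AE x\<in>{0..1} in lborel. poly ([:1, - 1:] ^ k * p) x * (1 - x) powr \<mu> =
      poly p x * (1 - x) powr (\<mu> + real k)"
    using AE_lborel_singleton[of 1]
  proof eventually_elim
    case (elim x)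
    then show ?case by (auto simp: powr_add powr_realpow)
  qed
  have "poly q \<in> borel_measurable borel" for q :: "real poly"
    by (intro borel_measurable_continuous_onI continuous_intros)
  note [measurable] = this
  show "(\<lambda>x. poly ([:1, - 1:] ^ k * p) x * (1 - x) powr \<mu>) \<in> borel_measurable lborel"
    "(\<lambda>x. poly p x * (1 - x) powr (\<mu> + real k)) \<in> borel_measurable lborel"
    by measurable
qed auto

text \<open>With \<open>u = 1 - t\<close> this is the operator \<open>u d/du + a\<close>, which is diagonal on powers of \<open>u\<close>.\<close>

definition euler_op :: "real \<Rightarrow> real poly \<Rightarrow> real poly" where
  "euler_op a p = smult a p - [:1, -1:] * pderiv p"

text \<open>Both terms of the product rule contain \<open>(1 - t) powr (a - 1)\<close>; what remains
  is an Euler operator applied to \<open>p\<close>. Differentiation thus becomes an operation on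
  polynomials.\<close>

lemma one_minus_powr_poly_has_derivative:
  assumes "t < (1::real)"
  shows "((\<lambda>t. (1 - t) powr a * poly p t) has_real_derivative
    - ((1 - t) powr (a - 1) * poly (euler_op a p) t)) (at t)"
proof -
  have *: "(1 - t) powr a = (1 - t) powr (a - 1) * (1 - t)"
    using assms powr_add[of "1 - t" "a - 1" 1] by simp
  have "((\<lambda>t. (1 - t) powr a * poly p t) has_real_derivative
      - (a * (1 - t) powr (a - 1)) * poly p t + (1 - t) powr a * poly (pderiv p) t) (at t)"
    using assms by (auto intro!: derivative_eq_intros)
  then show ?thesis
    by (rule DERIV_cong) (unfold *, simp add: euler_op_def algebra_simps)
qed

text \<open>The integrand is the exact derivative of
  \<open>- ((1 - t) powr (\<mu> + 1) * poly p t)\<close>. The boundary value at 1 vanishes because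
  \<open>\<mu> + 1 > 0\<close>, so only the value at 0 is left.\<close>

lemma jacobi_int_euler_op:
  assumes "\<mu> > -1"
  shows "jacobi_int \<mu> (euler_op (\<mu> + 1) p) = poly p 0"
proof -
  define G where "G = (\<lambda>t. - ((1 - t) powr (\<mu> + 1) * poly p t))"
  have "((\<lambda>t. (1 - t) powr \<mu> * poly (euler_op (\<mu> + 1) p) t) has_integral (G 1 - G 0)) {0..1}"
  proof (rule fundamental_theorem_of_calculus_interior)
    show "continuous_on {0..1} G"
      unfolding G_def using assms by (intro continuous_intros continuous_on_powr') auto
    show "(G has_vector_derivative (1 - t) powr \<mu> * poly (euler_op (\<mu> + 1) p) t) (at t)"
      if "t \<in> {0<..<1}" for t
      using DERIV_minus[OF one_minus_powr_poly_has_derivative[of t "\<mu> + 1" p]] that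
      unfolding G_def has_real_derivative_iff_has_vector_derivative[symmetric] by simp
  qed auto
  then have "integral {0..1} (\<lambda>t. poly (euler_op (\<mu> + 1) p) t * (1 - t) powr \<mu>) = poly p 0"
    by (simp add: G_def mult.commute integral_unique)
  then show ?thesis
    unfolding jacobi_int_def
    by (subst set_borel_integral_eq_integral(2)[OF jacobi_integrable[OF assms]])
qed

text \<open>The parameter \<open>\<mu> + k + 1\<close> would make the integrand exact, with boundary
  term \<open>poly g 0 = 0\<close>. The given operator differs from that one by a scalar, and only
  the scalar survives.\<close>

lemma jacobi_int_shift_euler_op:
  assumes "\<mu> > -1" and "poly g 0 = 0"
  shows "jacobi_int \<mu> ([:1, -1:] ^ k * euler_op a g) =
    (a - \<mu> - 1 - real k) * jacobi_int \<mu> ([:1, -1:] ^ k * g)"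
proof -
  have *: "\<mu> + real k > -1" using assms by simp
  have "euler_op a g = euler_op (\<mu> + real k + 1) g + smult (a - \<mu> - 1 - real k) g"
    by (simp add: euler_op_def algebra_simps smult_add_left smult_diff_left)
  then show ?thesis
    unfolding jacobi_int_shift using jacobi_int_euler_op[OF *, of g] assms
    by (simp add: jacobi_int_add[OF *] jacobi_int_smult)
qed

text \<open>These are Beta integrals \<open>I n\<close>. Exactness applied to 1 and to
  \<open>t ^ (n + 1)\<close> gives \<open>(\<mu> + 1) * I 0 = 1\<close> and
  \<open>(\<mu> + n + 2) * I (n + 1) = (n + 1) * I n\<close>, so positivity follows by
  induction.\<close>

lemma jacobi_int_monom_pos:
  assumes "\<mu> > -1"
  shows "jacobi_int \<mu> (monom 1 n) > 0"
proof (induction n)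
  case 0
  have "euler_op (\<mu> + 1) 1 = smult (\<mu> + 1) (monom 1 0)"
    by (simp add: euler_op_def monom_0)
  then have "(\<mu> + 1) * jacobi_int \<mu> (monom 1 0) = 1"
    using jacobi_int_euler_op[OF assms, of 1] by (simp only: jacobi_int_smult poly_1)
  then have "(\<mu> + 1) * jacobi_int \<mu> (monom 1 0) > 0" by linarith
  moreover have "\<mu> + 1 > 0" using assms by simp
  ultimately show ?case by (rule zero_less_mult_pos)
next
  case (Suc n)
  have "euler_op (\<mu> + 1) (monom 1 (Suc n)) =
      smult (\<mu> + 1 + real (Suc n)) (monom 1 (Suc n)) - smult (real (Suc n)) (monom 1 n)"
    by (rule poly_eqI) (auto simp: euler_op_def coeff_pCons pderiv_monom algebra_simps split: nat.split)
  moreover have "poly (monom 1 (Suc n)) (0::real) = 0" by (simp add: poly_monom)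
  ultimately have eq: "(\<mu> + 1 + real (Suc n)) * jacobi_int \<mu> (monom 1 (Suc n)) =
      real (Suc n) * jacobi_int \<mu> (monom 1 n)"
    using jacobi_int_euler_op[OF assms, of "monom 1 (Suc n)"]
    by (simp only: jacobi_int_smult jacobi_int_diff[OF assms])
  have "real (Suc n) * jacobi_int \<mu> (monom 1 n) > 0" using Suc by simp
  then have "(\<mu> + 1 + real (Suc n)) * jacobi_int \<mu> (monom 1 (Suc n)) > 0" using eq by linarith
  moreover have "\<mu> + 1 + real (Suc n) > 0" using assms by simp
  ultimately show ?case by (rule zero_less_mult_pos)
qed

section \<open>Effect of Euler operators on the order at 0 and on the top coefficient\<close>

lemma monom_dvd_euler_op:
  assumes "monom 1 (Suc n) dvd g"
  shows "monom 1 n dvd euler_op a g"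
  using assms unfolding monom_1_dvd_iff'
  by (auto simp: euler_op_def coeff_pCons coeff_pderiv split: nat.split)

lemma monom_dvd_foldr_euler_op:
  assumes "monom 1 (n + length as) dvd g"
  shows "monom 1 n dvd foldr euler_op as g"
  using assms
proof (induction as arbitrary: n)
  case (Cons a as)
  then show ?case using monom_dvd_euler_op[of n "foldr euler_op as g" a] by simp
qed simp

text \<open>Each operator costs at most one order of vanishing at 0. The divisibility hypothesis
  supplies one order per operator, so every intermediate polynomial still vanishes at 0 and each
  operator turns into its scalar.\<close>

lemma jacobi_int_shift_foldr_euler_op:
  assumes "\<mu> > -1" and "monom 1 (length as) dvd g"
  shows "jacobi_int \<mu> ([:1, -1:] ^ k * foldr euler_op as g) =
    (\<Prod>a\<leftarrow>as. a - \<mu> - 1 - real k) * jacobi_int \<mu> ([:1, -1:] ^ k * g)"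
  using assms(2)
proof (induction as)
  case (Cons a as)
  have "monom 1 1 dvd foldr euler_op as g"
    using Cons.prems by (intro monom_dvd_foldr_euler_op) simp
  then have "poly (foldr euler_op as g) 0 = 0" by (auto simp: poly_monom)
  moreover have "monom 1 (length as) dvd g"
    using Cons.prems by (simp add: monom_1_dvd_iff')
  ultimately show ?case
    using Cons.IH by (simp add: jacobi_int_shift_euler_op[OF assms(1)])
qed simp

text \<open>On \<open>t ^ d\<close> the term \<open>- (1 - t) d/dt\<close> contributes
  \<open>d * t ^ d\<close> and a lower power. The bound \<open>d\<close> may exceed the degree, so
  the lemma iterates without knowing that the degree is preserved.\<close>

lemma coeff_euler_op_degree:
  assumes "degree p \<le> d"
  shows "coeff (euler_op a p) d = (a + real d) * coeff p d"
proof (cases d)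
  case 0
  then have "pderiv p = 0" using assms by (simp add: pderiv_eq_0_iff)
  then show ?thesis using 0 by (simp add: euler_op_def)
next
  case (Suc e)
  then show ?thesis using assms
    by (simp add: euler_op_def coeff_pderiv algebra_simps coeff_eq_0)
qed

lemma degree_euler_op_le: "degree (euler_op a p) \<le> degree p"
proof (rule degree_le, intro allI impI)
  fix i assume "degree p < i"
  then show "coeff (euler_op a p) i = 0"
    by (cases i) (simp_all add: euler_op_def coeff_pderiv coeff_eq_0)
qed

lemma foldr_euler_op_degree:
  assumes "degree p \<le> d"
  shows "degree (foldr euler_op as p) \<le> d"
    and "coeff (foldr euler_op as p) d = (\<Prod>a\<leftarrow>as. a + real d) * coeff p d"
proof (induction as)
  case Nil
  case 1
  then show ?case using assms by simp
next
  case Nil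
  case 2
  then show ?case by simp
next
  case (Cons a as)
  case 1
  then show ?case using Cons degree_euler_op_le order_trans by fastforce
next
  case (Cons a as)
  case 2
  then show ?case using Cons by (simp add: coeff_euler_op_degree)
qed

section \<open>Duality of the Type I and Type II systems\<close>

text \<open>Parameters of the Euler operators in the Rodrigues formula. The block of index 0 stands
  last, so that \<open>foldr\<close> applies it first, which is the order of the formula.\<close>

fun euler_factors :: "(nat \<Rightarrow> real) \<Rightarrow> (nat \<Rightarrow> nat) \<Rightarrow> nat \<Rightarrow> real list" where
  "euler_factors \<mu> k 0 = []"
| "euler_factors \<mu> k (Suc n) =
     map (\<lambda>i. \<mu> n + real (Suc i)) [0..<k n] @ euler_factors \<mu> k n"

lemma length_euler_factors: "length (euler_factors \<mu> k n) = (\<Sum>l<n. k l)"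
  by (induction n) auto

lemma prod_list_euler_factors:
  "(\<Prod>a\<leftarrow>euler_factors \<mu> k n. f a :: real) = (\<Prod>l<n. \<Prod>i<k l. f (\<mu> l + real (Suc i)))"
proof (induction n)
  case (Suc n)
  have "(\<Prod>i\<leftarrow>[0..<k n]. f (\<mu> n + real (Suc i))) = (\<Prod>i<k n. f (\<mu> n + real (Suc i)))"
    by (simp add: prod.distinct_set_conv_list[symmetric] atLeast0LessThan)
  then show ?case using Suc by (simp add: o_def mult.commute)
qed simp

section \<open>Powers of \<open>1 - t\<close> as a basis\<close>

lemma coeff_one_minus_power: "coeff ([:1, -1::real:] ^ n) n = (-1) ^ n"
  using lead_coeff_power[of "[:1, -1::real:]" n] by (simp add: degree_power_eq)

lemma coeff_one_minus_power_eq_0: "i > n \<Longrightarrow> coeff ([:1, -1::real:] ^ n) i = 0"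
  by (rule coeff_eq_0) (simp add: degree_power_eq)

lemma reduce_by_one_minus_power:
  assumes "\<forall>i\<ge>Suc n. coeff (A :: real poly) i = 0"
  shows "\<exists>a. \<forall>i\<ge>n. coeff (A - smult a ([:1, -1:] ^ n)) i = 0"
proof (intro exI allI impI)
  fix i assume "n \<le> i"
  \<comment> \<open>The leading coefficient \<open>(-1) ^ n\<close> of \<open>(1 - t) ^ n\<close> is
    its own inverse, hence the multiplier \<open>(-1) ^ n * coeff A n\<close>.\<close>
  have "(-1) ^ n * (-1) ^ n = (1::real)" by (simp flip: power_mult_distrib)
  then show "coeff (A - smult ((-1) ^ n * coeff A n) ([:1, -1:] ^ n)) i = 0"
    using assms \<open>n \<le> i\<close>
    by (cases "i = n") (auto simp: coeff_one_minus_power coeff_one_minus_power_eq_0)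
qed

text \<open>Orthogonality is computed for powers of \<open>1 - t\<close>; this triangular change of
  basis transfers it to all polynomials of bounded degree.\<close>

lemma one_minus_power_expansion:
  assumes "\<forall>i\<ge>n. coeff (A :: real poly) i = 0"
  shows "\<exists>c. A = (\<Sum>i<n. smult (c i) ([:1, -1:] ^ i))"
  using assms
proof (induction n arbitrary: A)
  case 0
  then show ?case by (auto intro: poly_eqI)
next
  case (Suc n)
  obtain a where "\<forall>i\<ge>n. coeff (A - smult a ([:1, -1:] ^ n)) i = 0"
    using reduce_by_one_minus_power Suc.prems by blast
  then obtain c where c: "A - smult a ([:1, -1:] ^ n) = (\<Sum>i<n. smult (c i) ([:1, -1:] ^ i))"
    using Suc.IH by blast
  have "A = (\<Sum>i<Suc n. smult ((c(n := a)) i) ([:1, -1:] ^ i))"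
    using c by (simp add: algebra_simps)
  then show ?case by blast
qed

lemma poly_eq_sum_monoms:
  assumes "\<forall>i\<ge>n. coeff (q :: real poly) i = 0"
  shows "q = (\<Sum>s<n. smult (coeff q s) (monom 1 s))"
  using assms by (intro poly_eqI) (auto simp: coeff_sum if_distrib[of "(*) _"] cong: if_cong)

text \<open>Multi-indices are functions here, of which only the values below \<open>r\<close> count.
  The positive constants \<open>w\<close> leave room for the normalisation of the disk weights,
  which differs from weight to weight.\<close>

locale jp_system =
  fixes r :: nat and \<mu> w :: "nat \<Rightarrow> real"
  assumes \<mu>_gt: "l < r \<Longrightarrow> \<mu> l > -1"
    and \<mu>_diff: "i < r \<Longrightarrow> l < r \<Longrightarrow> i \<noteq> l \<Longrightarrow> \<mu> i - \<mu> l \<notin> \<int>"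
    and w_pos: "l < r \<Longrightarrow> w l > 0"
begin

section \<open>Orthogonality relations of the Type II polynomials\<close>

definition modulus :: "(nat \<Rightarrow> nat) \<Rightarrow> nat" where
  "modulus k = (\<Sum>l<r. k l)"

text \<open>Up to the sign \<open>(-1) ^ modulus k\<close> this is \<open>t ^ M\<close> times the
  polynomial of the Rodrigues formula.\<close>

definition kernel :: "nat \<Rightarrow> (nat \<Rightarrow> nat) \<Rightarrow> real poly" where
  "kernel M k = foldr euler_op (euler_factors \<mu> k r) (monom 1 (M + modulus k))"

text \<open>The top coefficient is a product of numbers \<open>\<mu> l + i + M + modulus k\<close>
  with \<open>i \<ge> 1\<close>, all positive because \<open>\<mu> l > -1\<close>.\<close>

lemma kernel_degree: "degree (kernel M k) \<le> M + modulus k"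
  and kernel_coeff_pos: "coeff (kernel M k) (M + modulus k) > 0"
proof -
  have d: "degree (monom 1 (M + modulus k) :: real poly) \<le> M + modulus k" by (simp add: degree_monom_le)
  show "degree (kernel M k) \<le> M + modulus k"
    unfolding kernel_def by (rule foldr_euler_op_degree(1)[OF d])
  have "0 < (\<Prod>l<r. \<Prod>i<k l. \<mu> l + real (Suc i) + real (M + modulus k))"
  proof (intro prod_pos ballI)
    fix l i assume "l \<in> {..<r}"
    then show "0 < \<mu> l + real (Suc i) + real (M + modulus k)" using \<mu>_gt[of l] by simp
  qed
  then show "coeff (kernel M k) (M + modulus k) > 0"
    unfolding kernel_def
    by (simp add: foldr_euler_op_degree(2)[OF d] prod_list_euler_factors)
qed

lemma monom_dvd_kernel: "monom 1 M dvd kernel M k"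
  unfolding kernel_def
  by (rule monom_dvd_foldr_euler_op) (simp add: length_euler_factors modulus_def)

lemma jacobi_int_kernel:
  assumes "l < r"
  shows "jacobi_int (\<mu> l) ([:1, -1:] ^ \<kappa> * kernel M k) =
    (\<Prod>l'<r. \<Prod>i<k l'. \<mu> l' + real i - \<mu> l - real \<kappa>) *
    jacobi_int (\<mu> l) ([:1, -1:] ^ \<kappa> * monom 1 (M + modulus k))"
  unfolding kernel_def
  by (subst jacobi_int_shift_foldr_euler_op[OF \<mu>_gt[OF assms]])
     (simp_all add: length_euler_factors modulus_def monom_1_dvd_iff' prod_list_euler_factors algebra_simps)

text \<open>Orthogonality: the factor with \<open>l' = l\<close> and \<open>i = \<kappa>\<close>
  vanishes.\<close>

lemma jacobi_int_kernel_eq_0: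
  assumes "l < r" and "\<kappa> < k l"
  shows "jacobi_int (\<mu> l) ([:1, -1:] ^ \<kappa> * kernel M k) = 0"
proof -
  have "(\<Prod>l'<r. \<Prod>i<k l'. \<mu> l' + real i - \<mu> l - real \<kappa>) = 0"
    using assms by (intro prod_zero bexI[of _ l] bexI[of _ \<kappa>]) auto
  then show ?thesis by (simp only: jacobi_int_kernel[OF assms(1)] mult_zero_left)
qed

text \<open>At the first exponent beyond the orthogonality relations, the factors with
  \<open>l' = l\<close> are \<open>i - k l < 0\<close>, and those with \<open>l' \<noteq> l\<close>
  could vanish only if \<open>\<mu> l' - \<mu> l\<close> were an integer. The remaining Beta
  integral is positive.\<close>

lemma jacobi_int_kernel_neq_0:
  assumes "l < r"
  shows "jacobi_int (\<mu> l) ([:1, -1:] ^ k l * kernel M k) \<noteq> 0"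
proof -
  have "\<mu> l' + real i - \<mu> l - real (k l) \<noteq> 0" if "l' < r" "i < k l'" for l' i
  proof (cases "l' = l")
    case False
    show ?thesis
    proof
      assume "\<mu> l' + real i - \<mu> l - real (k l) = 0"
      then have "\<mu> l' - \<mu> l = of_int (int (k l) - int i)" by simp
      then show False using \<mu>_diff[OF that(1) assms False] by (metis Ints_of_int)
    qed
  qed (use that in auto)
  then have "(\<Prod>l'<r. \<Prod>i<k l'. \<mu> l' + real i - \<mu> l - real (k l)) \<noteq> 0" by simp
  moreover have "jacobi_int (\<mu> l) ([:1, -1:] ^ k l * monom 1 (M + modulus k)) > 0"
    unfolding jacobi_int_shift using \<mu>_gt[OF assms] by (intro jacobi_int_monom_pos) simp
  ultimately show ?thesis by (simp only: jacobi_int_kernel[OF assms(1)] mult_eq_0_iff) simp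
qed

text \<open>In place of the derivative formula, \<open>t ^ M * p\<close> is required to be
  proportional to the kernel; \<open>p\<close> is monic so that its pairing with the dual Type I
  vector is 1.\<close>

definition is_typeII :: "nat \<Rightarrow> (nat \<Rightarrow> nat) \<Rightarrow> real poly \<Rightarrow> bool" where
  "is_typeII M k p \<longleftrightarrow> degree p = modulus k \<and> lead_coeff p = 1 \<and>
     (\<exists>c. c \<noteq> 0 \<and> monom 1 M * p = smult c (kernel M k))"

lemma is_typeII_exists: "\<exists>p. is_typeII M k p"
proof -
  obtain h where h: "kernel M k = monom 1 M * h" using monom_dvd_kernel by blast
  have c: "coeff h (modulus k) > 0" using kernel_coeff_pos[of M k] by (simp add: h coeff_monom_mult)
  then have "h \<noteq> 0" by auto
  then have "degree (kernel M k) = M + degree h"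
    unfolding h by (simp add: degree_mult_eq degree_monom_eq)
  then have "degree h \<le> modulus k" using kernel_degree[of M k] by simp
  with c have d: "degree h = modulus k" by (intro antisym le_degree) auto
  have "is_typeII M k (smult (inverse (lead_coeff h)) h)"
    unfolding is_typeII_def
  proof (intro conjI exI)
    show "monom 1 M * smult (inverse (lead_coeff h)) h = smult (inverse (lead_coeff h)) (kernel M k)"
      by (simp add: h)
  qed (use \<open>h \<noteq> 0\<close> c d in auto)
  then show ?thesis ..
qed

section \<open>The moment pairing and unique solvability of the Type I system\<close>

definition pairing :: "nat \<Rightarrow> (nat \<Rightarrow> real poly) \<Rightarrow> real poly \<Rightarrow> real" where
  "pairing M A q = (\<Sum>l<r. w l * jacobi_int (\<mu> l) (A l * (monom 1 M * q)))"

lemma pairing_sum: "pairing M A (\<Sum>i\<in>I. f i) = (\<Sum>i\<in>I. pairing M A (f i))"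
  unfolding pairing_def sum_distrib_left
  by (subst sum.swap) (auto intro!: sum.cong simp: jacobi_int_sum[OF \<mu>_gt] sum_distrib_left)

lemma pairing_smult: "pairing M A (smult c q) = c * pairing M A q"
  by (simp add: pairing_def jacobi_int_smult sum_distrib_left mult.left_commute)

lemma pairing_diff_left: "pairing M (\<lambda>l. A l - B l) q = pairing M A q - pairing M B q"
  by (simp add: pairing_def left_diff_distrib right_diff_distrib jacobi_int_diff[OF \<mu>_gt] sum_subtractf)

lemma pairing_add_left: "pairing M (\<lambda>l. A l + B l) q = pairing M A q + pairing M B q"
  by (simp add: pairing_def distrib_right distrib_left jacobi_int_add[OF \<mu>_gt] sum.distrib)

lemma pairing_smult_left: "pairing M (\<lambda>l. smult c (A l)) q = c * pairing M A q"
  by (simp add: pairing_def jacobi_int_smult sum_distrib_left mult.left_commute)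

lemma pairing_single:
  "l < r \<Longrightarrow> pairing M (\<lambda>i. if i = l then B else 0) q = w l * jacobi_int (\<mu> l) (B * (monom 1 M * q))"
  by (simp add: pairing_def if_distrib if_distribR cong: if_cong)

lemma pairing_expand:
  assumes "\<forall>i\<ge>n. coeff q i = 0"
  shows "pairing M A q = (\<Sum>s<n. coeff q s * pairing M A (monom 1 s))"
  by (subst poly_eq_sum_monoms[OF assms], subst pairing_sum) (simp only: pairing_smult)

text \<open>Degree bounds stated by coefficients cover the zero polynomial without a case
  distinction. Counting positions below \<open>r\<close>, the dimension is \<open>modulus k\<close>,
  the number of moment conditions.\<close>

definition coeff_space :: "(nat \<Rightarrow> nat) \<Rightarrow> (nat \<Rightarrow> real poly) set" where
  "coeff_space k = {A. \<forall>l<r. \<forall>i\<ge>k l. coeff (A l) i = 0}"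

lemma pairing_typeII_eq_0:
  assumes "is_typeII M k p" and "A \<in> coeff_space k"
  shows "pairing M A p = 0"
proof -
  obtain c where c: "monom 1 M * p = smult c (kernel M k)" using assms(1) unfolding is_typeII_def by auto
  have "jacobi_int (\<mu> l) (A l * (monom 1 M * p)) = 0" if l: "l < r" for l
  proof -
    obtain a where a: "A l = (\<Sum>i<k l. smult (a i) ([:1, -1:] ^ i))"
      using one_minus_power_expansion assms(2) l unfolding coeff_space_def by blast
    show ?thesis
      unfolding c a sum_distrib_right mult_smult_left mult_smult_right
      by (simp only: jacobi_int_sum[OF \<mu>_gt[OF l]] jacobi_int_smult)
         (auto intro!: sum.neutral simp: jacobi_int_kernel_eq_0[OF l])
  qed
  then show ?thesis by (simp add: pairing_def)
qed

lemma pairing_single_typeII_neq_0: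
  assumes "is_typeII M k p" and "l < r"
  shows "pairing M (\<lambda>i. if i = l then [:1, -1:] ^ k l else 0) p \<noteq> 0"
proof -
  obtain c where c: "c \<noteq> 0" "monom 1 M * p = smult c (kernel M k)"
    using assms(1) unfolding is_typeII_def by auto
  show ?thesis
    unfolding pairing_single[OF assms(2)] c(2) mult_smult_right jacobi_int_smult
    using c(1) w_pos[OF assms(2)] jacobi_int_kernel_neq_0[OF assms(2)] by simp
qed

lemma modulus_decr:
  assumes "l < r" and "k l > 0"
  shows "modulus k = Suc (modulus (k(l := k l - 1)))"
  using assms by (simp add: modulus_def sum.remove[of "{..<r}" l])

text \<open>Induction on \<open>modulus k\<close>, lowering one entry \<open>k l'\<close> by one.
  Modulo the smaller coefficient space, \<open>A\<close> is a multiple \<open>a\<close> of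
  \<open>(1 - t) ^ (k l' - 1)\<close> at position \<open>l'\<close>. Its pairing with the Type II
  polynomial \<open>p\<close> of the lowered index is 0, because \<open>degree p < modulus k\<close>
  and the moments of \<open>A\<close> vanish. As \<open>p\<close> annihilates the smaller space but
  not that power, \<open>a = 0\<close> and the induction applies.\<close>

lemma pairing_injective:
  assumes "A \<in> coeff_space k" and "\<forall>s<modulus k. pairing M A (monom 1 s) = 0" and "l < r"
  shows "A l = 0"
  using assms
proof (induction "modulus k" arbitrary: k)
  case 0
  then have "k l = 0" by (simp add: modulus_def)
  with 0 show ?case by (auto simp: coeff_space_def intro: poly_eqI)
next
  case (Suc N)
  obtain l' where l': "l' < r" "k l' > 0"
    using Suc.hyps(2) unfolding modulus_def by (metis lessThan_iff nat.distinct(1) neq0_conv sum.neutral)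
  define k' where "k' = k(l' := k l' - 1)"
  have N: "modulus k' = N" using modulus_decr[of l' k, OF l'] Suc.hyps(2) by (simp add: k'_def)
  obtain p where p: "is_typeII M k' p" using is_typeII_exists by blast
  obtain a where a: "\<forall>i\<ge>k' l'. coeff (A l' - smult a ([:1, -1:] ^ k' l')) i = 0"
    using reduce_by_one_minus_power[of "k' l'" "A l'"] Suc.prems(1) l'
    unfolding coeff_space_def k'_def by auto
  define E where "E = (\<lambda>i. if i = l' then [:1, -1:] ^ k' l' else (0 :: real poly))"
  define B where "B = (\<lambda>i. A i - smult a (E i))"
  have B: "B \<in> coeff_space k'"
    using Suc.prems(1) a unfolding coeff_space_def B_def E_def k'_def by auto
  have "pairing M A p = 0"
    using Suc.prems(2) p N Suc.hyps(2)
    by (subst pairing_expand[of "modulus k"]) (auto simp: is_typeII_def coeff_eq_0)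
  moreover have "pairing M B p = 0" by (rule pairing_typeII_eq_0[OF p B])
  ultimately have "a * pairing M E p = 0"
    unfolding B_def pairing_diff_left pairing_smult_left by simp
  then have "a = 0" using pairing_single_typeII_neq_0[OF p l'(1)] unfolding E_def by simp
  then have "A \<in> coeff_space k'" using B by (simp add: B_def)
  then show ?case
    using Suc.hyps(1)[of k'] N Suc.prems Suc.hyps(2) by auto
qed

text \<open>With one entry lowered, the smaller space provides \<open>A\<close> with the prescribed
  first \<open>N\<close> moments and \<open>C\<close> with those of the new vector \<open>E\<close>.
  Thus \<open>D = E - C\<close> affects only the last moment, and a multiple of it corrects
  \<open>A\<close> there.\<close>

lemma pairing_surjective:
  "\<exists>A\<in>coeff_space k. \<forall>s<modulus k. pairing M A (monom 1 s) = v s"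
proof (induction "modulus k" arbitrary: k v)
  case 0
  then show ?case by (intro bexI[of _ "\<lambda>_. 0"]) (auto simp: coeff_space_def)
next
  case (Suc N)
  obtain l where l: "l < r" "k l > 0"
    using Suc.hyps(2) unfolding modulus_def by (metis lessThan_iff nat.distinct(1) neq0_conv sum.neutral)
  define k' where "k' = k(l := k l - 1)"
  have N: "modulus k' = N" using modulus_decr[of l k, OF l] Suc.hyps(2) by (simp add: k'_def)
  obtain p where p: "is_typeII M k' p" using is_typeII_exists by blast
  define E where "E = (\<lambda>i. if i = l then [:1, -1:] ^ k' l else (0 :: real poly))"
  have le: "k' l' \<le> k l'" for l' by (simp add: k'_def)
  obtain C where C: "C \<in> coeff_space k'" "\<forall>s<N. pairing M C (monom 1 s) = pairing M E (monom 1 s)"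
    using Suc.hyps(1)[of k' "\<lambda>s. pairing M E (monom 1 s)"] N by auto
  obtain A where A: "A \<in> coeff_space k'" "\<forall>s<N. pairing M A (monom 1 s) = v s"
    using Suc.hyps(1)[of k' v] N by auto
  define D where "D = (\<lambda>i. E i - C i)"
  have D0: "\<forall>s<N. pairing M D (monom 1 s) = 0" using C(2) by (simp add: D_def pairing_diff_left)
  \<comment> \<open>The last moment of \<open>D\<close> is non-zero: its pairing with
    \<open>p\<close> is that of \<open>E\<close>, and in the expansion of \<open>p\<close> into
    monomials only degree \<open>N\<close> survives.\<close>
  have "pairing M D p = pairing M E p"
    using pairing_typeII_eq_0[OF p C(1)] by (simp add: D_def pairing_diff_left)
  moreover have "pairing M D p = (\<Sum>s<Suc N. coeff p s * pairing M D (monom 1 s))"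
    using p N by (intro pairing_expand) (auto simp: is_typeII_def coeff_eq_0)
  ultimately have DN: "pairing M D (monom 1 N) \<noteq> 0"
    using pairing_single_typeII_neq_0[OF p l(1)] D0 unfolding E_def by auto
  define a where "a = (v N - pairing M A (monom 1 N)) / pairing M D (monom 1 N)"
  have "pairing M (\<lambda>i. A i + smult a (D i)) (monom 1 s) = v s" if "s < modulus k" for s
  proof (cases "s = N")
    case True
    then show ?thesis using DN unfolding pairing_add_left pairing_smult_left a_def by simp
  next
    case False
    then show ?thesis
      using that Suc.hyps(2) A(2) D0 unfolding pairing_add_left pairing_smult_left by simp
  qed
  moreover have "(\<lambda>i. A i + smult a (D i)) \<in> coeff_space k"
    using A(1) C(1) l le unfolding coeff_space_def D_def E_def
    by (auto simp: k'_def coeff_one_minus_power_eq_0)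
  ultimately show ?case by blast
qed

section \<open>Biorthogonality and expansion in Type II polynomials\<close>

definition is_typeI :: "nat \<Rightarrow> (nat \<Rightarrow> nat) \<Rightarrow> (nat \<Rightarrow> real poly) \<Rightarrow> bool" where
  "is_typeI M k A \<longleftrightarrow> A \<in> coeff_space k \<and>
     (\<forall>s<modulus k. pairing M A (monom 1 s) = (if Suc s = modulus k then 1 else 0))"

lemma pairing_typeI_low_degree:
  assumes "is_typeI M k A" and "\<forall>i\<ge>n. coeff q i = 0" and "n < modulus k"
  shows "pairing M A q = 0"
  using assms by (subst pairing_expand[of n]) (auto simp: is_typeI_def)

lemma pairing_typeI_monic:
  assumes "is_typeI M k A" and "Suc (degree q) = modulus k"
  shows "pairing M A q = lead_coeff q"
proof -
  have "pairing M A q = (\<Sum>s<Suc (degree q). coeff q s * pairing M A (monom 1 s))"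
    by (rule pairing_expand) (auto simp: coeff_eq_0)
  also have "\<dots> = (\<Sum>s<Suc (degree q). if s = degree q then lead_coeff q else 0)"
    using assms by (intro sum.cong) (auto simp: is_typeI_def)
  also have "\<dots> = lead_coeff q" by simp
  finally show ?thesis .
qed

text \<open>The systems are biorthogonal along an increasing path. For \<open>i < i'\<close> the
  degree bounds of \<open>A i\<close> lie within those of \<open>k i'\<close>, so the orthogonality
  of \<open>p i'\<close> applies. For \<open>i > i'\<close> the degree of \<open>p i'\<close> stays
  below the last moment condition, and for \<open>i = i'\<close> that condition returns the leading
  coefficient 1.\<close>

lemma typeII_expansion:
  assumes k: "\<And>i. i \<le> Suc d \<Longrightarrow> modulus (k i) = i"
    and mono: "\<And>i i' l. i \<le> i' \<Longrightarrow> i' \<le> d \<Longrightarrow> l < r \<Longrightarrow> k i l \<le> k i' l"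
    and p: "\<And>i. i \<le> d \<Longrightarrow> is_typeII M (k i) (p i)"
    and A: "\<And>i. i \<le> d \<Longrightarrow> is_typeI M (k (Suc i)) (A i)"
    and q: "\<forall>i>d. coeff q i = 0"
  shows "q = (\<Sum>i\<le>d. smult (pairing M (A i) q) (p i))"
proof -
  have deg: "degree (p i) = i" "coeff (p i) i = 1" if "i \<le> d" for i
    using p[OF that] k[of i] that unfolding is_typeII_def by auto
  have dual: "pairing M (A i) (p i') = (if i = i' then 1 else 0)" if "i \<le> d" "i' \<le> d" for i i'
  proof (cases i i' rule: linorder_cases)
    case less
    then have "A i \<in> coeff_space (k i')"
      using A[OF that(1)] mono[of "Suc i" i'] that
      unfolding is_typeI_def coeff_space_def by (blast intro: order_trans Suc_leI)
    then show ?thesis using pairing_typeII_eq_0[OF p[OF that(2)]] less by simp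
  next
    case equal
    then show ?thesis
      using pairing_typeI_monic[OF A[OF that(1)], of "p i"] deg[OF that(1)] k[of "Suc i"] that by simp
  next
    case greater
    then show ?thesis
      using pairing_typeI_low_degree[OF A[OF that(1)], of "Suc i'" "p i'"]
        deg[OF that(2)] k[of "Suc i"] that by (simp add: coeff_eq_0)
  qed
  \<comment> \<open>Monic polynomials of each degree up to \<open>d\<close> span by triangular
    elimination; the coefficients are then read off with the dual system.\<close>
  have "\<exists>c. q = (\<Sum>i\<le>e. smult (c i) (p i))" if "e \<le> d" "\<forall>i>e. coeff q i = 0" for e q
    using that
  proof (induction e arbitrary: q)
    case 0
    have "q = smult (coeff q 0) (p 0)"
    proof (rule poly_eqI)
      fix i
      show "coeff q i = coeff (smult (coeff q 0) (p 0)) i"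
        using 0 deg[of 0] by (cases i) (auto simp: coeff_eq_0)
    qed
    then show ?case by (intro exI[of _ "\<lambda>_. coeff q 0"]) simp
  next
    case (Suc e)
    have "coeff (q - smult (coeff q (Suc e)) (p (Suc e))) i = 0" if "i > e" for i
      using Suc.prems deg[of "Suc e"] that by (cases "i = Suc e") (auto simp: coeff_eq_0)
    then have "\<forall>i>e. coeff (q - smult (coeff q (Suc e)) (p (Suc e))) i = 0" by blast
    moreover have "e \<le> d" using Suc.prems(1) by simp
    ultimately have "\<exists>c. q - smult (coeff q (Suc e)) (p (Suc e)) = (\<Sum>i\<le>e. smult (c i) (p i))"
      using Suc.IH by blast
    then obtain c where c: "q - smult (coeff q (Suc e)) (p (Suc e)) = (\<Sum>i\<le>e. smult (c i) (p i))" ..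
    have "q = (\<Sum>i\<le>Suc e. smult ((c(Suc e := coeff q (Suc e))) i) (p i))"
      using c by (simp add: algebra_simps)
    then show ?case by blast
  qed
  then obtain c where c: "q = (\<Sum>i\<le>d. smult (c i) (p i))" using q by blast
  have "pairing M (A i) q = c i" if "i \<le> d" for i
  proof -
    have "pairing M (A i) q = (\<Sum>i'\<le>d. c i' * pairing M (A i) (p i'))"
      by (subst c) (simp only: pairing_sum pairing_smult)
    also have "\<dots> = (\<Sum>i'\<le>d. if i = i' then c i' else 0)"
      using dual[OF that] by (intro sum.cong) auto
    also have "\<dots> = c i" using that by simp
    finally show ?thesis .
  qed
  then have "(\<Sum>i\<le>d. smult (pairing M (A i) q) (p i)) = (\<Sum>i\<le>d. smult (c i) (p i))"
    by (intro sum.cong) auto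
  then show ?thesis by (rule trans[OF c sym])
qed

end

section \<open>The Rodrigues formula and the Type I system\<close>

text \<open>The induction peels off the outermost derivative with \<open>a\<close> raised by one:
  the inner derivatives leave the exponent \<open>a + 1\<close>, and the last one adds the factor
  with parameter \<open>a + 1\<close>. The inner formula holds on a neighbourhood of
  \<open>t\<close>, which is all that a derivative sees.\<close>

lemma higher_deriv_one_minus_powr_poly:
  assumes "t < (1::real)"
  shows "(deriv ^^ k) (\<lambda>u. (1 - u) powr (a + real k) * poly g u) t =
    (-1) ^ k * (1 - t) powr a * poly (foldr euler_op (map (\<lambda>i. a + real (Suc i)) [0..<k]) g) t"
  using assms
proof (induction k arbitrary: a t)
  case (Suc k)
  define q where "q = foldr euler_op (map (\<lambda>i. a + 1 + real (Suc i)) [0..<k]) g"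
  have "\<forall>\<^sub>F x in nhds t. x < 1"
    using Suc.prems eventually_nhds_in_open[of "{..<1}" t] by simp
  then have "\<forall>\<^sub>F x in nhds t. (deriv ^^ k) (\<lambda>u. (1 - u) powr (a + real (Suc k)) * poly g u) x =
      (-1) ^ k * ((1 - x) powr (a + 1) * poly q x)"
  proof eventually_elim
    case (elim x)
    have "a + real (Suc k) = a + 1 + real k" by simp
    then show ?case using Suc.IH[OF elim, of "a + 1"] by (simp only: q_def mult.assoc)
  qed
  then have "(deriv ^^ Suc k) (\<lambda>u. (1 - u) powr (a + real (Suc k)) * poly g u) t =
      deriv (\<lambda>x. (-1) ^ k * ((1 - x) powr (a + 1) * poly q x)) t"
    by (simp add: deriv_cong_ev)
  also have "\<dots> = (-1) ^ k * - ((1 - t) powr (a + 1 - 1) * poly (euler_op (a + 1) q) t)"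
    by (intro DERIV_imp_deriv DERIV_cmult one_minus_powr_poly_has_derivative Suc.prems)
  also have "\<dots> = (-1) ^ Suc k * (1 - t) powr a *
      poly (foldr euler_op (map (\<lambda>i. a + real (Suc i)) [0..<Suc k]) g) t"
    unfolding q_def by (subst map_upt_Suc) (simp add: algebra_simps)
  finally show ?case .
qed simp

text \<open>The factor \<open>t ^ M\<close> of the weight is joined to \<open>f\<close>, since
  \<open>t ^ M * f\<close> is the polynomial on which the Euler operators act. The result carries
  the same factor, so the statement iterates.\<close>

lemma rodrigues_op_eq_poly:
  assumes g: "\<And>u. u \<in> {0<..<1} \<Longrightarrow> u ^ M * f u = poly g u" and t: "t \<in> {0<..<1}"
  shows "t ^ M * rodrigues_op M \<mu> k f t =
    (-1) ^ k * poly (foldr euler_op (map (\<lambda>i. \<mu> + real (Suc i)) [0..<k]) g) t"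
proof -
  have "\<forall>\<^sub>F u in nhds t. u \<in> {0<..<1}" by (rule eventually_nhds_in_open) (use t in auto)
  then have "\<forall>\<^sub>F u in nhds t. jp_weight M \<mu> u * (1 - u) ^ k * f u =
      (1 - u) powr (\<mu> + real k) * poly g u"
  proof eventually_elim
    case (elim u)
    then show ?case
      unfolding g[OF elim, symmetric] by (simp add: jp_weight_def powr_add powr_realpow)
  qed
  then have "(deriv ^^ k) (\<lambda>u. jp_weight M \<mu> u * (1 - u) ^ k * f u) t =
      (deriv ^^ k) (\<lambda>u. (1 - u) powr (\<mu> + real k) * poly g u) t"
    by (rule higher_deriv_cong_ev) simp
  then show ?thesis
    using t by (simp add: rodrigues_op_def higher_deriv_one_minus_powr_poly jp_weight_def)
qed

lemma fold_rodrigues_op: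
  assumes "t \<in> {0<..<1}"
  shows "t ^ M * fold (\<lambda>l. rodrigues_op M (\<mu> l) (k l)) [0..<n] (\<lambda>t. t ^ s) t =
    (-1) ^ (\<Sum>l<n. k l) * poly (foldr euler_op (euler_factors \<mu> k n) (monom 1 (M + s))) t"
  using assms
proof (induction n arbitrary: t)
  case 0
  then show ?case by (simp add: poly_monom power_add)
next
  case (Suc n)
  define g where
    "g = smult ((-1) ^ (\<Sum>l<n. k l)) (foldr euler_op (euler_factors \<mu> k n) (monom 1 (M + s)))"
  \<comment> \<open>The sign of the earlier factors is a scalar and passes through further Euler
    operators.\<close>
  have "euler_op a (smult c p) = smult c (euler_op a p)" for a c p
    by (rule poly_eqI) (simp add: euler_op_def pderiv_smult coeff_pCons algebra_simps split: nat.split)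
  then have *: "foldr euler_op as (smult c p) = smult c (foldr euler_op as p)" for as c p
    by (induction as) simp_all
  have "t ^ M * rodrigues_op M (\<mu> n) (k n)
      (fold (\<lambda>l. rodrigues_op M (\<mu> l) (k l)) [0..<n] (\<lambda>t. t ^ s)) t =
      (-1) ^ k n * poly (foldr euler_op (map (\<lambda>i. \<mu> n + real (Suc i)) [0..<k n]) g) t"
    by (rule rodrigues_op_eq_poly) (use Suc in \<open>simp_all add: g_def\<close>)
  then show ?case by (simp add: g_def * power_add mult.assoc)
qed

lemma poly_eqI_unit_interval:
  assumes "\<And>t. t \<in> {0<..<1} \<Longrightarrow> poly p t = poly q (t :: real)"
  shows "p = q"
proof (rule ccontr)
  assume "p \<noteq> q"
  then have "finite {t. poly (p - q) t = 0}" by (intro poly_roots_finite) simp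
  moreover have "{0<..<1} \<subseteq> {t. poly (p - q) t = 0}" using assms by auto
  ultimately have "finite {0<..<1::real}" by (rule finite_subset[rotated])
  then show False using infinite_Ioo[of 0 "1::real"] by simp
qed

section \<open>The defined polynomials as solutions of the abstract Type I and Type II
  systems\<close>

locale disk_weights =
  fixes \<mu> :: "real list"
  assumes \<mu>_gt: "\<forall>i<length \<mu>. \<mu> ! i > -1"
    and \<mu>_diff: "\<forall>i<length \<mu>. \<forall>i'<length \<mu>. i \<noteq> i' \<longrightarrow> \<mu> ! i - \<mu> ! i' \<notin> \<int>"
begin

sublocale jp_system "length \<mu>" "\<lambda>l. \<mu> ! l" "\<lambda>l. disk_weight_const (\<mu> ! l)"
proof
  fix l assume "l < length \<mu>"
  then show "disk_weight_const (\<mu> ! l) > 0"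
    using \<mu>_gt[rule_format, of l] by (simp add: disk_weight_const_def)
qed (use \<mu>_gt \<mu>_diff in auto)

lemma modulus_nth: "length k = length \<mu> \<Longrightarrow> modulus ((!) k) = sum_list k"
  by (simp add: modulus_def sum_list_sum_nth atLeast0LessThan)

lemma is_typeII_jp_typeII:
  assumes k: "length k = length \<mu>"
  shows "is_typeII M ((!) k) (jp_typeII M \<mu> k)"
proof -
  obtain p c where p: "degree p = modulus ((!) k)" "lead_coeff p = 1" "c \<noteq> 0"
    "monom 1 M * p = smult c (kernel M ((!) k))"
    using is_typeII_exists[of M "(!) k"] unfolding is_typeII_def by blast
  \<comment> \<open>The Rodrigues polynomial is \<open>b * p\<close>: the sign comes from the
    derivatives, and \<open>c\<close> relates \<open>t ^ M * p\<close> to the kernel. Division by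
    the leading coefficient \<open>b\<close> restores \<open>p\<close>.\<close>
  define b where "b = (-1) ^ sum_list k / c"
  have b: "b \<noteq> 0" using p(3) by (simp add: b_def)
  have fun_eq: "poly (smult b p) t = rodrigues_fun M \<mu> k t" if t: "t \<in> {0<..<1}" for t
  proof -
    have "t ^ M * rodrigues_fun M \<mu> k t = (-1) ^ sum_list k * poly (kernel M ((!) k)) t"
      using fold_rodrigues_op[OF t, of M "(!) \<mu>" "(!) k" "length \<mu>" "sum_list k"] modulus_nth[OF k]
      unfolding rodrigues_fun_def kernel_def modulus_def by simp
    also have "\<dots> = b * poly (smult c (kernel M ((!) k))) t" using p(3) by (simp add: b_def)
    also have "\<dots> = t ^ M * poly (smult b p) t" unfolding p(4)[symmetric] by (simp add: poly_monom)
    finally show ?thesis using t by simp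
  qed
  have "rodrigues_poly M \<mu> k = smult b p"
    unfolding rodrigues_poly_def
  proof (rule the_equality)
    fix q assume "\<forall>t\<in>{0<..<1}. poly q t = rodrigues_fun M \<mu> k t"
    then show "q = smult b p" using fun_eq by (intro poly_eqI_unit_interval) simp
  qed (use fun_eq in blast)
  then have "jp_typeII M \<mu> k = p" using b p(2) by (simp add: jp_typeII_def)
  then show ?thesis using p unfolding is_typeII_def by auto
qed

lemma pairing_cong: "(\<And>l. l < length \<mu> \<Longrightarrow> A l = B l) \<Longrightarrow> pairing M A q = pairing M B q"
  by (simp add: pairing_def)

lemma is_jp_typeI_iff:
  assumes "length k = length \<mu>"
  shows "is_jp_typeI M \<mu> k A \<longleftrightarrow> length A = length \<mu> \<and> is_typeI M ((!) k) ((!) A)"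
proof -
  have int: "(LBINT t:{0..1}. poly p t * t ^ s * (b * jp_weight M a t)) =
      b * jacobi_int a (p * (monom 1 M * monom 1 s))" for p s a b
    unfolding jacobi_int_def set_integral_mult_right[symmetric]
    by (simp add: jp_weight_def poly_monom mult_ac)
  have deg: "(p = 0 \<or> degree p < n) = (\<forall>i\<ge>n. coeff p i = 0)" for p :: "real poly" and n
  proof
    assume "\<forall>i\<ge>n. coeff p i = 0"
    then show "p = 0 \<or> degree p < n" by (metis leading_coeff_0_iff not_le)
  qed (auto simp: coeff_eq_0)
  show ?thesis
    unfolding is_jp_typeI_def is_typeI_def pairing_def coeff_space_def modulus_nth[OF assms]
      int deg mem_Collect_eq ..
qed

text \<open>Surjectivity of the moment map gives a solution, and injectivity applied to the
  difference of two solutions gives uniqueness, so the description in \<open>jp_typeI\<close>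
  denotes it.\<close>

lemma is_typeI_jp_typeI:
  assumes k: "length k = length \<mu>"
  shows "is_typeI M ((!) k) ((!) (jp_typeI M \<mu> k))"
proof -
  obtain A where "A \<in> coeff_space ((!) k)"
    "\<forall>s<modulus ((!) k). pairing M A (monom 1 s) = (if Suc s = modulus ((!) k) then 1 else 0)"
    using pairing_surjective[of "(!) k" M "\<lambda>s. if Suc s = modulus ((!) k) then 1 else 0"] by (rule bexE)
  then have A: "is_typeI M ((!) k) A" unfolding is_typeI_def by blast
  \<comment> \<open>\<open>A\<close> is determined only at positions below
    \<open>length \<mu>\<close>; the list keeps exactly these.\<close>
  define As where "As = map A [0..<length \<mu>]"
  have nth: "As ! l = A l" if "l < length \<mu>" for l using that by (simp add: As_def)
  have "pairing M ((!) As) q = pairing M A q" for q by (rule pairing_cong) (rule nth)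
  moreover have "(!) As \<in> coeff_space ((!) k) \<longleftrightarrow> A \<in> coeff_space ((!) k)"
    unfolding coeff_space_def by (auto simp: nth)
  ultimately have "is_typeI M ((!) k) ((!) As)"
    using A unfolding is_typeI_def by simp
  then have As: "is_jp_typeI M \<mu> k As" by (simp add: is_jp_typeI_iff[OF k] As_def)
  have "is_jp_typeI M \<mu> k (jp_typeI M \<mu> k)"
    unfolding jp_typeI_def
  proof (rule theI)
    fix Bs assume "is_jp_typeI M \<mu> k Bs"
    then have Bs: "length Bs = length \<mu>" "is_typeI M ((!) k) ((!) Bs)"
      by (simp_all add: is_jp_typeI_iff[OF k])
    have "Bs ! l - As ! l = 0" if "l < length \<mu>" for l
    proof (rule pairing_injective[OF _ _ that])
      show "(\<lambda>l. Bs ! l - As ! l) \<in> coeff_space ((!) k)"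
        using Bs(2) As unfolding is_jp_typeI_iff[OF k] is_typeI_def coeff_space_def by auto
      show "\<forall>s<modulus ((!) k). pairing M (\<lambda>l. Bs ! l - As ! l) (monom 1 s) = 0"
        using Bs(2) As unfolding is_jp_typeI_iff[OF k] is_typeI_def pairing_diff_left by auto
    qed
    then show "Bs = As" using Bs(1) by (intro nth_equalityI) (auto simp: As_def)
  qed (rule As)
  then show ?thesis using is_jp_typeI_iff[OF k] by blast
qed

end

section \<open>Integration over the disk\<close>

lemma shear_fst_lborel:
  "distr lborel borel (\<lambda>(x, y). (x + a * y, y)) = (lborel :: (real \<times> real) measure)"
proof (rule measure_eqI)
  fix A :: "(real \<times> real) set" assume "A \<in> sets (distr lborel borel (\<lambda>(x, y). (x + a * y, y)))"
  then have A [measurable]: "A \<in> sets borel" by simp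
  have [measurable]: "(\<lambda>(x, y). (x + a * y, y)) \<in> borel_measurable (borel :: (real \<times> real) measure)"
    unfolding borel_prod[symmetric] by measurable
  have [measurable]: "A \<in> sets (borel \<Otimes>\<^sub>M borel)" by (subst borel_prod) (rule A)
  have "emeasure (distr lborel borel (\<lambda>(x, y). (x + a * y, y))) A =
      (\<integral>\<^sup>+p. indicator A p \<partial>distr lborel borel (\<lambda>(x, y). (x + a * y, y)))"
    by (rule nn_integral_indicator[symmetric]) simp
  also have "\<dots> = (\<integral>\<^sup>+p. indicator A ((\<lambda>(x, y). (x + a * y, y)) p) \<partial>lborel)"
    by (rule nn_integral_distr) auto
  also have "\<dots> = (\<integral>\<^sup>+p. indicator A ((\<lambda>(x, y). (x + a * y, y)) p) \<partial>(lborel \<Otimes>\<^sub>M lborel))"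
    by (simp add: lborel_prod)
  also have "\<dots> = (\<integral>\<^sup>+y. (\<integral>\<^sup>+x. indicator A (x + a * y, y) \<partial>lborel) \<partial>lborel)"
    by (subst lborel_pair.nn_integral_snd[symmetric]) (auto simp: measurable_split_conv borel_prod)
  also have "\<dots> = (\<integral>\<^sup>+y. (\<integral>\<^sup>+x. indicator A (x, y) \<partial>lborel) \<partial>lborel)"
  proof (rule nn_integral_cong)
    fix y :: real
    \<comment> \<open>For fixed \<open>y\<close> the shear is a translation in \<open>x\<close>, so
      translation invariance applies to the inner integral.\<close>
    have "(\<integral>\<^sup>+x. indicator A (x, y) \<partial>lborel) = (\<integral>\<^sup>+x. indicator A (x, y) \<partial>distr lborel borel ((+) (a * y)))"
      by (simp only: lborel_distr_plus)
    also have "\<dots> = (\<integral>\<^sup>+x. indicator A (x + a * y, y) \<partial>lborel)"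
      by (subst nn_integral_distr) (auto simp: add.commute)
    finally show "(\<integral>\<^sup>+x. indicator A (x + a * y, y) \<partial>lborel) = (\<integral>\<^sup>+x. indicator A (x, y) \<partial>lborel)" ..
  qed
  also have "\<dots> = (\<integral>\<^sup>+p. indicator A p \<partial>(lborel \<Otimes>\<^sub>M lborel))"
    by (subst lborel_pair.nn_integral_snd[symmetric]) (auto simp: measurable_split_conv borel_prod)
  also have "\<dots> = emeasure lborel A" by (simp add: lborel_prod)
  finally show "emeasure (distr lborel borel (\<lambda>(x, y). (x + a * y, y))) A = emeasure lborel A" .
qed simp

lemma swap_lborel:
  "distr lborel borel (\<lambda>(x, y). (y, x)) = (lborel :: (real \<times> real) measure)"
proof -
  have "lborel = distr lborel (lborel :: (real \<times> real) measure) (\<lambda>(x, y). (y, x))"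
    using lborel_pair.distr_pair_swap by (simp only: lborel_prod)
  also have "\<dots> = distr lborel borel (\<lambda>(x, y). (y, x))" by (rule distr_cong) auto
  finally show ?thesis ..
qed

definition rotation :: "real \<Rightarrow> real \<times> real \<Rightarrow> real \<times> real" where
  "rotation \<phi> = (\<lambda>(x, y). (cos \<phi> * x - sin \<phi> * y, sin \<phi> * x + cos \<phi> * y))"

lemma rotation_measurable [measurable]: "rotation \<phi> \<in> borel_measurable borel"
  unfolding rotation_def borel_prod[symmetric] by measurable

text \<open>A rotation is the product of three shears, each of which preserves the measure. The
  outer two have slope \<open>b = - tan (\<phi> / 2)\<close>, whence the exclusion of half
  turns.\<close>

lemma rotation_lborel:
  assumes "cos \<phi> \<noteq> -1"
  shows "distr lborel borel (rotation \<phi>) = lborel"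
proof -
  define b where "b = - (sin \<phi> / (1 + cos \<phi>))"
  define S :: "real \<Rightarrow> real \<times> real \<Rightarrow> real \<times> real" where "S = (\<lambda>a (x, y). (x + a * y, y))"
  define W :: "real \<times> real \<Rightarrow> real \<times> real" where "W = (\<lambda>(x, y). (y, x))"
  have S [measurable]: "S a \<in> borel_measurable borel" for a
    unfolding S_def borel_prod[symmetric] by measurable
  have W [measurable]: "W \<in> borel_measurable borel"
    unfolding W_def borel_prod[symmetric] by measurable
  define pres :: "(real \<times> real \<Rightarrow> real \<times> real) \<Rightarrow> bool"
    where "pres = (\<lambda>f. f \<in> borel_measurable borel \<and> distr lborel borel f = lborel)"
  have inv: "pres (S a)" "pres W" for a
    using shear_fst_lborel swap_lborel S W by (simp_all add: pres_def S_def W_def)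
  have comp: "pres (f \<circ> g)" if f: "pres f" and g: "pres g" for f g
  proof -
    have m: "f \<in> measurable borel borel" "g \<in> measurable lborel borel"
      using f g by (simp_all add: pres_def)
    have "distr lborel borel (f \<circ> g) = distr (distr lborel borel g) borel f"
      by (rule distr_distr[OF m, symmetric])
    then show ?thesis using f g unfolding pres_def by (auto intro: measurable_comp)
  qed
  have nz: "1 + cos \<phi> \<noteq> 0" using assms by linarith
  have "sin \<phi> * sin \<phi> = (1 - cos \<phi>) * (1 + cos \<phi>)"
    using sin_cos_squared_add[of \<phi>] by (simp add: power2_eq_square algebra_simps)
  then have b1: "1 + sin \<phi> * b = cos \<phi>" and b2: "b * (1 + cos \<phi>) = - sin \<phi>"
    using nz by (simp_all add: b_def field_simps)
  \<comment> \<open>Conjugation by the swap \<open>W\<close> turns a shear of the first coordinate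
    into one of the second.\<close>
  have "rotation \<phi> p = (S b \<circ> (W \<circ> (S (sin \<phi>) \<circ> (W \<circ> S b)))) p" for p
  proof (cases p)
    case (Pair x y)
    have "y + sin \<phi> * (x + b * y) = sin \<phi> * x + (1 + sin \<phi> * b) * y" by (simp add: algebra_simps)
    then have y: "y + sin \<phi> * (x + b * y) = sin \<phi> * x + cos \<phi> * y" by (simp only: b1)
    have "x + b * y + b * (sin \<phi> * x + cos \<phi> * y) = (1 + sin \<phi> * b) * x + (b * (1 + cos \<phi>)) * y"
      by (simp add: algebra_simps)
    then have "x + b * y + b * (sin \<phi> * x + cos \<phi> * y) = cos \<phi> * x - sin \<phi> * y"
      by (simp only: b1 b2)
    with y show ?thesis by (simp add: Pair S_def W_def rotation_def)
  qed
  then have "rotation \<phi> = S b \<circ> (W \<circ> (S (sin \<phi>) \<circ> (W \<circ> S b)))" ..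
  moreover have "pres (S b \<circ> (W \<circ> (S (sin \<phi>) \<circ> (W \<circ> S b))))" by (intro comp inv)
  ultimately show ?thesis by (simp add: pres_def)
qed

section \<open>Radial integrals in the variable \<open>t\<close>, the squared radius\<close>

definition sqnorm :: "real \<times> real \<Rightarrow> real" where
  "sqnorm p = (fst p)\<^sup>2 + (snd p)\<^sup>2"

lemma sqnorm_measurable [measurable]: "sqnorm \<in> borel_measurable borel"
  unfolding sqnorm_def borel_prod[symmetric] by measurable

lemma disk_eq_sqnorm: "disk = {p. sqnorm p \<le> 1}"
  by (auto simp: disk_def sqnorm_def)

lemma disk_sets [measurable]: "disk \<in> sets borel"
  unfolding disk_eq_sqnorm by measurable

text \<open>This replaces polar coordinates: a disk of squared radius \<open>t\<close> has area \<open>pi * t\<close>.\<close>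

lemma distr_sqnorm:
  "distr (restrict_space lborel disk) borel sqnorm = density lborel (\<lambda>t. ennreal pi * indicator {0..1} t)"
    (is "?M = ?N")
proof (rule measure_eqI_lessThan)
  have ball: "emeasure lborel {p. sqnorm p \<le> t} = ennreal (pi * t)" if "t \<ge> 0" for t
  proof -
    have "{p. sqnorm p \<le> t} = cball (0 :: real \<times> real) (sqrt t)"
      using that by (auto simp: sqnorm_def norm_Pair)
    then show ?thesis using that by (simp add: emeasure_cball eval_unit_ball_vol unit_ball_vol_2)
  qed
  have meas [measurable]: "sqnorm \<in> measurable (restrict_space lborel disk) borel"
    by (intro measurable_restrict_space1) simp
  have M: "emeasure ?M {t<..} = emeasure lborel {p. t < sqnorm p \<and> sqnorm p \<le> 1}" for t
  proof -
    have "sqnorm -` {t<..} \<inter> space (restrict_space lborel disk) = {p. t < sqnorm p \<and> sqnorm p \<le> 1}"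
      by (auto simp: space_restrict_space disk_eq_sqnorm)
    moreover have "emeasure ?M {t<..} = emeasure (restrict_space lborel disk)
        (sqnorm -` {t<..} \<inter> space (restrict_space lborel disk))"
      by (rule emeasure_distr) auto
    moreover have "emeasure (restrict_space lborel disk) {p. t < sqnorm p \<and> sqnorm p \<le> 1} =
        emeasure lborel {p. t < sqnorm p \<and> sqnorm p \<le> 1}"
      by (rule emeasure_restrict_space) (auto simp: disk_eq_sqnorm)
    ultimately show ?thesis by simp
  qed
  have N: "emeasure ?N {t<..} = ennreal pi * emeasure lborel ({t<..} \<inter> {0..1})" for t
    by (subst emeasure_density)
       (auto simp: mult.assoc indicator_inter_arith[symmetric] nn_integral_cmult Int_commute)
  \<comment> \<open>For \<open>0 \<le> t \<le> 1\<close> the preimage of the half-line in the disk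
    is an annulus of area \<open>pi * (1 - t)\<close>.\<close>
  show "emeasure ?M {t<..} = emeasure ?N {t<..}" for t
  proof -
    consider "t < 0" | "0 \<le> t" "t \<le> 1" | "t > 1" by linarith
    then show ?thesis
    proof cases
      case 1
      then have "{p. t < sqnorm p \<and> sqnorm p \<le> 1} = {p. sqnorm p \<le> 1}"
        by (auto simp: sqnorm_def intro: less_le_trans)
      moreover have "{t<..} \<inter> {0..1} = {0..1}" using 1 by auto
      ultimately show ?thesis unfolding M N using ball[of 1] by simp
    next
      case 2
      have "{p. t < sqnorm p \<and> sqnorm p \<le> 1} = {p. sqnorm p \<le> 1} - {p. sqnorm p \<le> t}" by auto
      also have "emeasure lborel \<dots> = ennreal pi - ennreal (pi * t)"
        using 2 ball[of 1] ball[of t] by (subst emeasure_Diff) auto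
      also have "\<dots> = ennreal (pi * (1 - t))"
        using 2 by (subst ennreal_minus) (auto simp: algebra_simps)
      moreover have "{t<..} \<inter> {0..1} = {t<..1}" using 2 by auto
      ultimately show ?thesis unfolding M N using 2 by (simp add: ennreal_mult)
    next
      case 3
      then have e: "{p. t < sqnorm p \<and> sqnorm p \<le> 1} = {}" "{t<..} \<inter> {0..1} = {}" by auto
      show ?thesis unfolding M N e by simp
    qed
  qed
  show "emeasure ?M {t<..} < \<infinity>" for t
  proof -
    have "emeasure ?M {t<..} \<le> emeasure lborel {p. sqnorm p \<le> 1}"
      unfolding M by (intro emeasure_mono) auto
    also have "\<dots> < \<infinity>" using ball[of 1] by simp
    finally show ?thesis .
  qed
qed auto

lemma disk_radial:
  fixes h :: "real \<Rightarrow> 'a :: {banach, second_countable_topology}"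
  assumes [measurable]: "h \<in> borel_measurable borel"
  shows disk_radial_integrable: "set_integrable lborel disk (\<lambda>p. h (sqnorm p)) \<longleftrightarrow> set_integrable lborel {0..1} h"
    and disk_radial_integral: "(LINT p:disk|lborel. h (sqnorm p)) = pi *\<^sub>R (LBINT t:{0..1}. h t)"
proof -
  have meas [measurable]: "sqnorm \<in> measurable (restrict_space lborel disk) borel"
    by (intro measurable_restrict_space1) simp
  have d: "density lborel (\<lambda>t. ennreal pi * indicator {0..1} t) =
      density lborel (\<lambda>t. ennreal (pi * indicator {0..1} t))"
    by (intro arg_cong[of _ _ "density lborel"]) (auto simp: indicator_def)
  have "set_integrable lborel disk (\<lambda>p. h (sqnorm p)) \<longleftrightarrow>
      integrable (restrict_space lborel disk) (\<lambda>p. h (sqnorm p))"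
    by (subst integrable_restrict_space) (auto simp: set_integrable_def)
  also have "\<dots> \<longleftrightarrow> integrable (distr (restrict_space lborel disk) borel sqnorm) h"
    by (subst integrable_distr_eq) auto
  also have "\<dots> \<longleftrightarrow> integrable lborel (\<lambda>t. pi *\<^sub>R (indicator {0..1} t *\<^sub>R h t))"
    unfolding distr_sqnorm d by (subst integrable_density) auto
  also have "\<dots> \<longleftrightarrow> set_integrable lborel {0..1} h"
    using integrable_scaleR_right[of pi lborel "\<lambda>t. indicator {0..1} t *\<^sub>R h t"]
      integrable_scaleR_right[of "1 / pi" lborel "\<lambda>t. pi *\<^sub>R (indicator {0..1} t *\<^sub>R h t)"]
    unfolding set_integrable_def by simp blast
  finally show "set_integrable lborel disk (\<lambda>p. h (sqnorm p)) \<longleftrightarrow> set_integrable lborel {0..1} h" .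
  have "(LINT p:disk|lborel. h (sqnorm p)) = integral\<^sup>L (restrict_space lborel disk) (\<lambda>p. h (sqnorm p))"
    by (subst integral_restrict_space) (auto simp: set_lebesgue_integral_def)
  also have "\<dots> = integral\<^sup>L (distr (restrict_space lborel disk) borel sqnorm) h"
    by (subst integral_distr) auto
  also have "\<dots> = (LINT t|lborel. pi *\<^sub>R (indicator {0..1} t *\<^sub>R h t))"
    unfolding distr_sqnorm d by (subst integral_density) auto
  also have "\<dots> = pi *\<^sub>R (LBINT t:{0..1}. h t)"
    by (simp only: set_lebesgue_integral_def integral_scaleR_right)
  finally show "(LINT p:disk|lborel. h (sqnorm p)) = pi *\<^sub>R (LBINT t:{0..1}. h t)" .
qed

section \<open>Harmonics as parts of complex powers, and their orthogonality\<close>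

definition cpoint :: "real \<times> real \<Rightarrow> complex" where
  "cpoint p = Complex (fst p) (snd p)"

lemma cpoint_measurable [measurable]: "cpoint \<in> borel_measurable borel"
  unfolding cpoint_def Complex_eq borel_prod[symmetric] by measurable

lemma norm_cpoint: "(cmod (cpoint p))\<^sup>2 = sqnorm p"
  by (simp add: cpoint_def sqnorm_def cmod_power2)

lemma cmod_cpoint_power_le_1:
  assumes "p \<in> disk"
  shows "cmod (cpoint p) ^ k \<le> 1"
proof -
  have "(cmod (cpoint p))\<^sup>2 \<le> 1\<^sup>2" using assms by (simp add: norm_cpoint disk_eq_sqnorm)
  then have "cmod (cpoint p) \<le> 1" by (rule power2_le_imp_le) simp
  then show ?thesis by (intro power_le_one) auto
qed

lemma cpoint_rotation: "cpoint (rotation \<phi> p) = cis \<phi> * cpoint p"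
  by (cases p) (simp add: cpoint_def rotation_def complex_eq_iff)

lemma sqnorm_rotation [simp]: "sqnorm (rotation \<phi> p) = sqnorm p"
  by (simp flip: norm_cpoint add: cpoint_rotation norm_mult)

lemma disk_integral_rotation:
  fixes f :: "real \<times> real \<Rightarrow> 'a :: {banach, second_countable_topology}"
  assumes [measurable]: "f \<in> borel_measurable borel" and "cos \<phi> \<noteq> -1"
  shows "(LINT p:disk|lborel. f (rotation \<phi> p)) = (LINT p:disk|lborel. f p)"
proof -
  have "(LINT p:disk|lborel. f p) = (LINT p:disk|distr lborel borel (rotation \<phi>). f p)"
    using rotation_lborel[OF assms(2)] by simp
  also have "\<dots> = (LINT p|lborel. indicator disk (rotation \<phi> p) *\<^sub>R f (rotation \<phi> p))"
    unfolding set_lebesgue_integral_def by (subst integral_distr) auto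
  also have "\<dots> = (LINT p:disk|lborel. f (rotation \<phi> p))"
    unfolding set_lebesgue_integral_def
    by (intro Bochner_Integration.integral_cong) (auto simp: disk_eq_sqnorm indicator_def)
  finally show ?thesis ..
qed

text \<open>De Moivre's formula. With complex powers, rotations act by scalars and multiplication by
  a coordinate is complex algebra.\<close>

lemma Yharm_eq: "Yharm \<nu> M p = (if \<nu> = 1 then Re (cpoint p ^ M) else Im (cpoint p ^ M))"
proof -
  have "cpoint p = complex_of_real (cmod (cpoint p)) * cis (Arg (cpoint p))"
    using rcis_cmod_Arg[of "cpoint p"] by (simp add: rcis_def)
  then have "cpoint p ^ M = complex_of_real (cmod (cpoint p)) ^ M * cis (Arg (cpoint p)) ^ M"
    by (metis power_mult_distrib)
  then have "cpoint p ^ M = complex_of_real (cmod (cpoint p) ^ M) * cis (real M * Arg (cpoint p))"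
    by (simp only: Complex.DeMoivre of_real_power)
  then have "Re (cpoint p ^ M) = cmod (cpoint p) ^ M * cos (real M * Arg (cpoint p))"
    "Im (cpoint p ^ M) = cmod (cpoint p) ^ M * sin (real M * Arg (cpoint p))"
    by (simp_all only: Re_complex_of_real Im_complex_of_real times_complex.sel cis.sel)
  moreover have "Yharm \<nu> M p = cmod (cpoint p) ^ M *
      (if \<nu> = 1 then cos (real M * Arg (cpoint p)) else sin (real M * Arg (cpoint p)))"
    by (cases p) (simp add: Yharm_def cpoint_def complex_norm)
  ultimately show ?thesis by simp
qed

lemma cnj_measurable [measurable]: "cnj \<in> borel_measurable borel"
  by (intro borel_measurable_continuous_onI continuous_intros)

lemma Yharm_2_0: "\<nu> \<noteq> 1 \<Longrightarrow> Yharm \<nu> 0 p = 0"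
  by (simp add: Yharm_eq)

lemma disk_bounded_mult_integrable:
  fixes f :: "real \<times> real \<Rightarrow> complex"
  assumes [measurable]: "h \<in> borel_measurable borel" "f \<in> borel_measurable borel"
    and h: "set_integrable lborel {0..1} h" and f: "\<And>p. p \<in> disk \<Longrightarrow> cmod (f p) \<le> 1"
  shows "set_integrable lborel disk (\<lambda>p. complex_of_real (h (sqnorm p)) * f p)"
proof -
  have "integrable lborel (\<lambda>p. indicator disk p *\<^sub>R h (sqnorm p))"
    using disk_radial_integrable[of h] h by (simp add: set_integrable_def)
  then show ?thesis
    unfolding set_integrable_def
  proof (rule Bochner_Integration.integrable_bound)
    show "AE p in lborel. norm (indicator disk p *\<^sub>R (complex_of_real (h (sqnorm p)) * f p))
        \<le> norm (indicator disk p *\<^sub>R h (sqnorm p))"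
      using f by (auto simp: indicator_def norm_mult intro!: mult_left_le)
  qed simp
qed

text \<open>The rotation preserves the integral and the radial factor but multiplies
  \<open>f\<close> by \<open>\<i>\<close>, so the integral \<open>I\<close> satisfies
  \<open>I = \<i> * I\<close>.\<close>

lemma disk_angular_zero:
  fixes f :: "real \<times> real \<Rightarrow> complex"
  assumes [measurable]: "h \<in> borel_measurable borel" "f \<in> borel_measurable borel"
    and "cos \<phi> \<noteq> -1" and f: "\<And>p. f (rotation \<phi> p) = \<i> * f p"
  shows "(LINT p:disk|lborel. complex_of_real (h (sqnorm p)) * f p) = 0"
proof -
  define F where "F = (\<lambda>p. complex_of_real (h (sqnorm p)) * f p)"
  have [measurable]: "F \<in> borel_measurable borel" unfolding F_def by measurable
  have "(LINT p:disk|lborel. F p) = (LINT p:disk|lborel. F (rotation \<phi> p))"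
    by (simp add: disk_integral_rotation assms(3))
  also have "\<dots> = \<i> * (LINT p:disk|lborel. F p)"
    unfolding set_integral_mult_right[symmetric] by (simp add: F_def f mult_ac)
  finally have "(1 - \<i>) * (LINT p:disk|lborel. F p) = 0" by (simp add: algebra_simps)
  moreover have "1 - \<i> \<noteq> 0" by (simp add: complex_eq_iff)
  ultimately show ?thesis unfolding F_def by simp
qed

lemma cos_quarter_neq:
  assumes "k \<ge> (1::nat)"
  shows "cos (pi / 2 / real k) \<noteq> -1"
proof -
  have "pi / 2 / real k \<le> pi / 2" using assms by (simp add: divide_le_eq mult_le_cancel_left1)
  then have "cos (pi / 2 / real k) \<ge> 0" by (intro cos_ge_zero) (auto intro: order_trans[of _ 0])
  then show ?thesis by auto
qed

text \<open>A rotation by \<open>\<phi>\<close> multiplies the product by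
  \<open>cis ((M + M') * \<phi>)\<close>, so the angle \<open>pi / 2 / (M + M')\<close> produces the
  factor \<open>\<i>\<close>.\<close>

lemma disk_integral_power_mult:
  assumes h: "h \<in> borel_measurable borel" and M: "M + M' > 0"
  shows "(LINT p:disk|lborel. complex_of_real (h (sqnorm p)) * (cpoint p ^ M * cpoint p ^ M')) = 0"
proof (rule disk_angular_zero[OF h])
  show "cos (pi / 2 / real (M + M')) \<noteq> -1" by (rule cos_quarter_neq) (use M in linarith)
  fix p
  have "cis (pi / 2 / real (M + M')) ^ (M + M') = \<i>"
    unfolding Complex.DeMoivre using M by (simp del: of_nat_add)
  then show "cpoint (rotation (pi / 2 / real (M + M')) p) ^ M * cpoint (rotation (pi / 2 / real (M + M')) p) ^ M' =
      \<i> * (cpoint p ^ M * cpoint p ^ M')"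
    by (simp add: cpoint_rotation power_mult_distrib mult_ac flip: power_add)
qed simp

lemma disk_integral_power_cnj:
  assumes h: "h \<in> borel_measurable borel" and M: "M \<noteq> M'"
  shows "(LINT p:disk|lborel. complex_of_real (h (sqnorm p)) * (cpoint p ^ M * cnj (cpoint p ^ M'))) = 0"
proof -
  \<comment> \<open>The product with a conjugate turns by \<open>(M - M') * \<phi>\<close>, which
    has to be a quarter turn; the cases keep the subtraction of naturals untruncated.\<close>
  define \<phi> where "\<phi> = (if M > M' then pi / 2 / real (M - M') else - (pi / 2 / real (M' - M)))"
  have M\<phi>: "real M * \<phi> + - (real M' * \<phi>) = pi / 2"
  proof (cases "M > M'")
    case True
    have "real M * \<phi> + - (real M' * \<phi>) = real (M - M') * \<phi>" using True by (simp add: algebra_simps of_nat_diff)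
    then show ?thesis using True by (simp add: \<phi>_def del: of_nat_diff)
  next
    case False
    have "real M * \<phi> + - (real M' * \<phi>) = - real (M' - M) * \<phi>" using False by (simp add: algebra_simps of_nat_diff)
    then show ?thesis using False M by (simp add: \<phi>_def del: of_nat_diff)
  qed
  show ?thesis
  proof (rule disk_angular_zero[OF h])
    show "cos \<phi> \<noteq> -1"
    proof (cases "M > M'")
      case True
      then show ?thesis unfolding \<phi>_def using cos_quarter_neq[of "M - M'"] by simp
    next
      case False
      then show ?thesis unfolding \<phi>_def using M cos_quarter_neq[of "M' - M"] by simp
    qed
    fix p
    have "cis \<phi> ^ M * cnj (cis \<phi> ^ M') = \<i>"
      unfolding Complex.DeMoivre cis_cnj cis_mult M\<phi> by simp
    then show "cpoint (rotation \<phi> p) ^ M * cnj (cpoint (rotation \<phi> p) ^ M') =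
        \<i> * (cpoint p ^ M * cnj (cpoint p ^ M'))"
      unfolding cpoint_rotation power_mult_distrib complex_cnj_mult by (metis mult.assoc mult.left_commute)
  qed simp
qed

lemma disk_integral_power_same:
  assumes [measurable]: "h \<in> borel_measurable borel"
  shows "(LINT p:disk|lborel. complex_of_real (h (sqnorm p)) * (cpoint p ^ M * cnj (cpoint p ^ M))) =
    complex_of_real (pi * (LBINT t:{0..1}. h t * t ^ M))"
proof -
  have "cpoint p ^ M * cnj (cpoint p ^ M) = complex_of_real (sqnorm p ^ M)" for p
    unfolding complex_norm_square[symmetric] norm_cpoint[symmetric]
    by (simp add: norm_power mult.commute flip: power_mult)
  then have "(LINT p:disk|lborel. complex_of_real (h (sqnorm p)) * (cpoint p ^ M * cnj (cpoint p ^ M))) =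
      (LINT p:disk|lborel. complex_of_real (h (sqnorm p) * sqnorm p ^ M))" by simp
  also have "\<dots> = complex_of_real (LINT p:disk|lborel. h (sqnorm p) * sqnorm p ^ M)"
    by (rule set_integral_complex_of_real)
  also have "(LINT p:disk|lborel. h (sqnorm p) * sqnorm p ^ M) = pi * (LBINT t:{0..1}. h t * t ^ M)"
    using disk_radial_integral[of "\<lambda>t. h t * t ^ M"] by simp
  finally show ?thesis .
qed

text \<open>A product of real or imaginary parts is half a sum or difference of parts of
  \<open>F\<close> and \<open>G\<close>. \<open>F\<close> integrates to 0 unless both degrees are 0,
  and \<open>G\<close> unless they agree; in degree 0 the two coincide, which doubles the norm. For
  \<open>\<eta> = 2\<close>, \<open>M > 0\<close> excludes the zero harmonic, for which
  \<open>Ynorm2\<close> still gives \<open>pi\<close>.\<close>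

lemma disk_integral_Yharm:
  assumes [measurable]: "h \<in> borel_measurable borel" and h: "set_integrable lborel {0..1} h"
    and "\<eta> \<in> {1, 2}" "\<eta>' \<in> {1, 2}" and M0: "\<eta> = 2 \<longrightarrow> M > 0"
  shows "(LINT p:disk|lborel. h (sqnorm p) * (Yharm \<eta>' M' p * Yharm \<eta> M p)) =
    (if \<eta>' = \<eta> \<and> M' = M then Ynorm2 \<eta> M / 2 * (LBINT t:{0..1}. h t * t ^ M) else 0)"
proof -
  define F where "F = (\<lambda>p. complex_of_real (h (sqnorm p)) * (cpoint p ^ M' * cpoint p ^ M))"
  define G where "G = (\<lambda>p. complex_of_real (h (sqnorm p)) * (cpoint p ^ M' * cnj (cpoint p ^ M)))"
  have FG: "set_integrable lborel disk F" "set_integrable lborel disk G"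
    unfolding F_def G_def using cmod_cpoint_power_le_1
    by (auto intro!: disk_bounded_mult_integrable h mult_le_one simp: norm_mult norm_power)
  have ReIm: "(LINT p:disk|lborel. Re (u p)) = Re (LINT p:disk|lborel. u p)"
    "(LINT p:disk|lborel. Im (u p)) = Im (LINT p:disk|lborel. u p)"
    if "set_integrable lborel disk u" for u :: "real \<times> real \<Rightarrow> complex"
    using integral_Re[OF that[unfolded set_integrable_def]] integral_Im[OF that[unfolded set_integrable_def]]
    by (simp_all add: set_lebesgue_integral_def)
  have ReIm_integrable: "set_integrable lborel disk (\<lambda>p. Re (u p))" "set_integrable lborel disk (\<lambda>p. Im (u p))"
    if "set_integrable lborel disk u" for u :: "real \<times> real \<Rightarrow> complex"
    using integrable_Re[OF that[unfolded set_integrable_def]] integrable_Im[OF that[unfolded set_integrable_def]]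
    by (simp_all add: set_integrable_def)
  have G0: "M' \<noteq> M \<Longrightarrow> (LINT p:disk|lborel. G p) = 0"
    unfolding G_def by (rule disk_integral_power_cnj) auto
  have G1: "M' = M \<Longrightarrow> (LINT p:disk|lborel. G p) = complex_of_real (pi * (LBINT t:{0..1}. h t * t ^ M))"
    unfolding G_def by (simp only: disk_integral_power_same[OF assms(1)])
  have F0: "M' + M > 0 \<Longrightarrow> (LINT p:disk|lborel. F p) = 0"
    unfolding F_def by (rule disk_integral_power_mult) auto
  have FG0: "M' + M = 0 \<Longrightarrow> F = G" by (auto simp: F_def G_def)
  note int = FG[THEN ReIm_integrable(1)] FG[THEN ReIm_integrable(2)]
  consider "\<eta>' = 1" "\<eta> = 1" | "\<eta>' = 1" "\<eta> = 2" | "\<eta>' = 2" "\<eta> = 1" | "\<eta>' = 2" "\<eta> = 2"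
    using assms(3,4) by auto
  then show ?thesis
  proof cases
    case 1
    have "h (sqnorm p) * (Yharm \<eta>' M' p * Yharm \<eta> M p) = 1 / 2 * (Re (G p) + Re (F p))" for p
      using 1 by (simp add: Yharm_eq F_def G_def algebra_simps del: complex_cnj_power)
    then have "(LINT p:disk|lborel. h (sqnorm p) * (Yharm \<eta>' M' p * Yharm \<eta> M p)) =
        1 / 2 * (Re (LINT p:disk|lborel. G p) + Re (LINT p:disk|lborel. F p))"
      by (simp only: set_integral_mult_right set_integral_add int ReIm[OF FG(1)] ReIm[OF FG(2)])
    then show ?thesis using 1 G0 G1 F0 FG0 by (cases "M' + M = 0") (auto simp: Ynorm2_def)
  next
    case 2
    have "h (sqnorm p) * (Yharm \<eta>' M' p * Yharm \<eta> M p) = 1 / 2 * (Im (F p) - Im (G p))" for p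
      using 2 by (simp add: Yharm_eq F_def G_def algebra_simps del: complex_cnj_power)
    then have "(LINT p:disk|lborel. h (sqnorm p) * (Yharm \<eta>' M' p * Yharm \<eta> M p)) =
        1 / 2 * (Im (LINT p:disk|lborel. F p) - Im (LINT p:disk|lborel. G p))"
      by (simp only: set_integral_mult_right set_integral_diff int ReIm[OF FG(1)] ReIm[OF FG(2)])
    then show ?thesis using 2 G0 G1 F0 FG0 by (cases "M' = M"; cases "M' + M = 0") auto
  next
    case 3
    have "h (sqnorm p) * (Yharm \<eta>' M' p * Yharm \<eta> M p) = 1 / 2 * (Im (F p) + Im (G p))" for p
      using 3 by (simp add: Yharm_eq F_def G_def algebra_simps del: complex_cnj_power)
    then have "(LINT p:disk|lborel. h (sqnorm p) * (Yharm \<eta>' M' p * Yharm \<eta> M p)) =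
        1 / 2 * (Im (LINT p:disk|lborel. F p) + Im (LINT p:disk|lborel. G p))"
      by (simp only: set_integral_mult_right set_integral_add int ReIm[OF FG(1)] ReIm[OF FG(2)])
    then show ?thesis using 3 G0 G1 F0 FG0 by (cases "M' = M"; cases "M' + M = 0") auto
  next
    case 4
    have "h (sqnorm p) * (Yharm \<eta>' M' p * Yharm \<eta> M p) = 1 / 2 * (Re (G p) - Re (F p))" for p
      using 4 by (simp add: Yharm_eq F_def G_def algebra_simps del: complex_cnj_power)
    then have "(LINT p:disk|lborel. h (sqnorm p) * (Yharm \<eta>' M' p * Yharm \<eta> M p)) =
        1 / 2 * (Re (LINT p:disk|lborel. G p) - Re (LINT p:disk|lborel. F p))"
      by (simp only: set_integral_mult_right set_integral_diff int ReIm[OF FG(1)] ReIm[OF FG(2)])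
    then show ?thesis using 4 G0 G1 F0 M0 by (auto simp: Ynorm2_def)
  qed
qed

section \<open>The recurrence\<close>

lemma Yharm_measurable [measurable]: "Yharm \<nu> M \<in> borel_measurable borel"
  unfolding Yharm_eq[abs_def] by measurable

lemma abs_Yharm_le_1:
  assumes "p \<in> disk"
  shows "\<bar>Yharm \<nu> M p\<bar> \<le> 1"
proof -
  have "cmod (cpoint p ^ M) \<le> 1"
    using cmod_cpoint_power_le_1[OF assms, of M] by (simp add: norm_power)
  then show ?thesis
    unfolding Yharm_eq
    using abs_Re_le_cmod[of "cpoint p ^ M"] abs_Im_le_cmod[of "cpoint p ^ M"] by auto
qed

lemma disk_Yharm_integrable:
  assumes [measurable]: "h \<in> borel_measurable borel" and h: "set_integrable lborel {0..1} h"
  shows "set_integrable lborel disk (\<lambda>p. h (sqnorm p) * (Yharm \<eta>' M' p * Yharm \<eta> M p))"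
proof -
  have "set_integrable lborel disk (\<lambda>p. complex_of_real (h (sqnorm p)) *
      complex_of_real (Yharm \<eta>' M' p * Yharm \<eta> M p))"
  proof (rule disk_bounded_mult_integrable[OF assms(1) _ h])
    show "cmod (complex_of_real (Yharm \<eta>' M' p * Yharm \<eta> M p)) \<le> 1" if "p \<in> disk" for p
      unfolding norm_of_real abs_mult using that by (intro mult_le_one abs_Yharm_le_1) auto
  qed simp
  then show ?thesis
    using integrable_Re unfolding set_integrable_def by fastforce
qed

section \<open>Steps of a path and scalar products of block vectors\<close>

lemma sum_list_plus_unit: "l < length v \<Longrightarrow> sum_list (plus_unit v l) = Suc (sum_list v)"
  using elem_le_sum_list[of l v] by (simp add: plus_unit_def sum_list_update)

lemma plus_unit_nth_le: "i < length v \<Longrightarrow> v ! i \<le> plus_unit v l ! i"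
  by (cases "i = l") (simp_all add: plus_unit_def)

text \<open>Subtracting a unit vector would lower the modulus, so a step that raises it adds
  one.\<close>

lemma neighbours_nth_le:
  assumes "neighbours u v" and "sum_list v = Suc (sum_list u)" and "i < length u"
  shows "u ! i \<le> v ! i"
  using assms plus_unit_nth_le sum_list_plus_unit unfolding neighbours_def by fastforce

text \<open>The second block omits the index with \<open>2 * i = k\<close>. The hypothesis makes
  that term 0, so both blocks can be summed over the same range.\<close>

lemma scalar_prod_block_vec:
  assumes "\<And>i. 2 * i = k \<Longrightarrow> P i 2 = 0"
  shows "scalar_prod (block_vec k c) (block_vec k P) = (\<Sum>\<eta>\<in>{1, 2}. \<Sum>i | 2 * i \<le> k. c i \<eta> * P i \<eta>)"
proof -
  have fin: "finite {i. 2 * i \<le> k}" by (rule finite_subset[of _ "{..k}"]) auto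
  have s: "(\<Sum>i\<leftarrow>filter Q [0..<Suc k]. f i) = (\<Sum>i\<in>{i. i \<le> k \<and> Q i}. f i)" for Q and f :: "nat \<Rightarrow> real"
    by (subst sum_list_distinct_conv_sum_set) (auto intro!: sum.cong simp del: upt_Suc)
  have "scalar_prod (block_vec k c) (block_vec k P) =
      (\<Sum>i\<leftarrow>filter (\<lambda>i. 2 * i \<le> k) [0..<Suc k]. c i 1 * P i 1) +
      (\<Sum>i\<leftarrow>filter (\<lambda>i. 2 * i < k) [0..<Suc k]. c i 2 * P i 2)"
    unfolding scalar_prod_def block_vec_def by (simp only: zip_append length_map map_append sum_list_append map2_map_map)
  also have "\<dots> = (\<Sum>i | 2 * i \<le> k. c i 1 * P i 1) + (\<Sum>i | 2 * i < k. c i 2 * P i 2)"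
    unfolding s by (intro arg_cong2[of _ _ _ _ "(+)"] sum.cong) auto
  also have "(\<Sum>i | 2 * i < k. c i 2 * P i 2) = (\<Sum>i | 2 * i \<le> k. c i 2 * P i 2)"
    using assms by (intro sum.mono_neutral_left fin) auto
  finally show ?thesis by simp
qed

section \<open>Recurrence coefficients as radial pairings\<close>

context disk_weights
begin

text \<open>The factor \<open>t ^ M\<close> is left out: on the disk it arises from the product of
  two harmonics of degree \<open>M\<close>.\<close>

definition typeI_fun :: "(nat \<Rightarrow> real poly) \<Rightarrow> real \<Rightarrow> real" where
  "typeI_fun A t = (\<Sum>l<length \<mu>. poly (A l) t * (disk_weight_const (\<mu> ! l) * (1 - t) powr (\<mu> ! l)))"

lemma typeI_fun_measurable [measurable]: "typeI_fun A \<in> borel_measurable borel"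
proof -
  have [measurable]: "poly q \<in> borel_measurable borel" for q :: "real poly"
    by (intro borel_measurable_continuous_onI continuous_intros)
  show ?thesis unfolding typeI_fun_def[abs_def] by measurable
qed

lemma typeI_fun_integral:
  shows typeI_fun_integrable: "set_integrable lborel {0..1} (\<lambda>t. poly q t * typeI_fun A t)"
    and pairing_eq_integral: "pairing M A q = (LBINT t:{0..1}. poly q t * typeI_fun A t * t ^ M)"
proof -
  have int: "set_integrable lborel {0..1} (\<lambda>t. poly q t * typeI_fun A t)"
    and eq: "(LBINT t:{0..1}. poly q t * typeI_fun A t) =
      (\<Sum>l<length \<mu>. disk_weight_const (\<mu> ! l) * jacobi_int (\<mu> ! l) (A l * q))" for q
  proof -
    define g where "g = (\<lambda>l t. disk_weight_const (\<mu> ! l) * (poly (A l * q) t * (1 - t) powr (\<mu> ! l)))"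
    have g: "set_integrable lborel {0..1} (g l)" if "l < length \<mu>" for l
      unfolding g_def by (intro set_integrable_mult_right jacobi_integrable) (use \<mu>_gt that in auto)
    have fun_eq: "poly q t * typeI_fun A t = (\<Sum>l<length \<mu>. g l t)" for t
      by (simp add: typeI_fun_def g_def sum_distrib_left mult_ac)
    show "set_integrable lborel {0..1} (\<lambda>t. poly q t * typeI_fun A t)"
      unfolding fun_eq set_integrable_def scaleR_sum_right
      by (rule Bochner_Integration.integrable_sum) (use g in \<open>auto simp: set_integrable_def\<close>)
    have "(LBINT t:{0..1}. poly q t * typeI_fun A t) = (\<Sum>l<length \<mu>. LBINT t:{0..1}. g l t)"
      unfolding fun_eq set_lebesgue_integral_def scaleR_sum_right
      by (rule Bochner_Integration.integral_sum) (use g in \<open>auto simp: set_integrable_def\<close>)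
    also have "\<dots> = (\<Sum>l<length \<mu>. disk_weight_const (\<mu> ! l) * jacobi_int (\<mu> ! l) (A l * q))"
      unfolding g_def jacobi_int_def by simp
    finally show "(LBINT t:{0..1}. poly q t * typeI_fun A t) = \<dots>" .
  qed
  show "set_integrable lborel {0..1} (\<lambda>t. poly q t * typeI_fun A t)" by (rule int)
  show "pairing M A q = (LBINT t:{0..1}. poly q t * typeI_fun A t * t ^ M)"
    using eq[of "monom 1 M * q"] by (simp add: pairing_def poly_monom mult_ac)
qed

lemma disk_Q_eq:
  "disk_Q \<mu> n j \<nu> p = typeI_fun ((!) (jp_typeI (sum_list n - 2 * sum_list j) \<mu> j)) (sqnorm p) *
    Yharm \<nu> (sum_list n - 2 * sum_list j) p"
  by (cases p)
     (simp add: disk_Q_def disk_A_def disk_weight_def typeI_fun_def sqnorm_def sum_distrib_left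
       Let_def mult_ac diff_diff_eq)

lemma disk_P_eq:
  "disk_P \<mu> n j \<nu> p = poly (jp_typeII (sum_list n - 2 * sum_list j) \<mu> j) (sqnorm p) *
    Yharm \<nu> (sum_list n - 2 * sum_list j) p"
  by (cases p) (simp add: disk_P_def sqnorm_def Let_def)

lemma disk_inner_Yharm_Q:
  assumes "\<eta> \<in> {1, 2}" "\<eta>' \<in> {1, 2}" and "\<eta> = 2 \<longrightarrow> K > 0"
  shows "(LINT p:disk|lborel. poly q (sqnorm p) * Yharm \<eta>' M p * (typeI_fun A (sqnorm p) * Yharm \<eta> K p)) =
      (if \<eta>' = \<eta> \<and> M = K then Ynorm2 \<eta> K / 2 * pairing K A q else 0)" (is ?eq)
    and "set_integrable lborel disk
      (\<lambda>p. poly q (sqnorm p) * Yharm \<eta>' M p * (typeI_fun A (sqnorm p) * Yharm \<eta> K p))" (is ?int)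
proof -
  define h where "h = (\<lambda>t. poly q t * typeI_fun A t)"
  have [measurable]: "poly q \<in> borel_measurable borel"
    by (intro borel_measurable_continuous_onI continuous_intros)
  have h: "h \<in> borel_measurable borel" unfolding h_def by measurable
  have hi: "set_integrable lborel {0..1} h" unfolding h_def by (rule typeI_fun_integrable)
  have e: "poly q (sqnorm p) * Yharm \<eta>' M p * (typeI_fun A (sqnorm p) * Yharm \<eta> K p) =
      h (sqnorm p) * (Yharm \<eta>' M p * Yharm \<eta> K p)" for p
    by (simp add: h_def)
  show ?int unfolding e by (rule disk_Yharm_integrable[OF h hi])
  show ?eq unfolding e disk_integral_Yharm[OF h hi assms]
    by (simp only: h_def pairing_eq_integral)
qed

text \<open>Raising the moduli to \<open>k + 2\<close> and \<open>i + 1\<close> keeps the harmonic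
  degree \<open>k - 2 * i\<close>, so \<open>disk_Q\<close> meets only the part of \<open>f\<close>
  of that degree and kind. The angular integration leaves half of the norm, which
  \<open>2 / Ynorm2\<close> cancels.\<close>

lemma rec_coeff_eq:
  assumes f: "\<And>p. f p = poly q1 (sqnorm p) * Yharm \<eta>' M1 p + poly q2 (sqnorm p) * Yharm \<eta>' M2 p"
    and "M1 \<noteq> M2" and \<eta>: "\<eta> \<in> {1, 2}" "\<eta>' \<in> {1, 2}" "\<eta> = 2 \<Longrightarrow> 2 * i < k"
    and m: "sum_list (m (k + 2)) = k + 2" "sum_list (m (i + 1)) = i + 1"
  shows "rec_coeff \<mu> m f k i \<eta> =
    (if \<eta>' = \<eta> \<and> M1 = k - 2 * i then pairing M1 ((!) (jp_typeI M1 \<mu> (m (i + 1)))) q1 else 0) +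
    (if \<eta>' = \<eta> \<and> M2 = k - 2 * i then pairing M2 ((!) (jp_typeI M2 \<mu> (m (i + 1)))) q2 else 0)"
proof -
  define K where "K = k - 2 * i"
  define A where "A = (!) (jp_typeI K \<mu> (m (i + 1)))"
  have K: "\<eta> = 2 \<longrightarrow> K > 0" using \<eta>(3) by (simp add: K_def)
  have "sum_list (m (k + 2)) - 2 * sum_list (m (i + 1)) = K" unfolding m K_def by simp
  then have Q: "disk_Q \<mu> (m (k + 2)) (m (i + 1)) \<eta> p = typeI_fun A (sqnorm p) * Yharm \<eta> K p" for p
    by (simp only: disk_Q_eq A_def)
  have "disk_inner f (disk_Q \<mu> (m (k + 2)) (m (i + 1)) \<eta>) =
      (if \<eta>' = \<eta> \<and> M1 = K then Ynorm2 \<eta> K / 2 * pairing K A q1 else 0) +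
      (if \<eta>' = \<eta> \<and> M2 = K then Ynorm2 \<eta> K / 2 * pairing K A q2 else 0)"
    unfolding disk_inner_def f Q distrib_right
    by (subst set_integral_add(2)[OF disk_inner_Yharm_Q(2)[OF \<eta>(1,2) K] disk_inner_Yharm_Q(2)[OF \<eta>(1,2) K]])
       (simp_all only: disk_inner_Yharm_Q(1)[OF \<eta>(1,2) K])
  moreover have "Ynorm2 \<eta> K \<noteq> 0" by (simp add: Ynorm2_def)
  ultimately show ?thesis
    unfolding rec_coeff_def K_def[symmetric] using assms(2) by (auto simp: A_def)
qed

text \<open>Entry \<open>i\<close> of block \<open>k\<close> has harmonic degree
  \<open>k - 2 * i\<close>, so it contributes only if this is \<open>M + 1\<close> or
  \<open>M - 1\<close>. Exchanging the sums over \<open>k\<close> and \<open>i\<close> leaves, for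
  each of the two degrees, the Type II expansion of \<open>q1\<close> or \<open>q2\<close>. Since
  \<open>N = M + 2 * J\<close>, the bound \<open>k \<le> N + 1\<close> means
  \<open>i \<le> J\<close> for degree \<open>M + 1\<close> and, if \<open>M > 0\<close>,
  \<open>i \<le> J + 1\<close> for degree \<open>M - 1\<close>, which matches the degree
  bounds.\<close>

lemma recurrence:
  fixes m :: "nat \<Rightarrow> nat list" and N J :: nat
  defines "M \<equiv> N - 2 * J"
  assumes J: "2 * J \<le> N" and \<eta>': "\<eta>' \<in> {1, 2}"
    and f: "\<And>p. f p = poly q1 (sqnorm p) * Yharm \<eta>' (M + 1) p + poly q2 (sqnorm p) * Yharm \<eta>' (M - 1) p"
    and q1: "degree q1 \<le> J" and q2: "degree q2 \<le> J + 1" "M = 0 \<Longrightarrow> q2 = 0"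
    and m: "\<And>k. k \<le> N + 3 \<Longrightarrow> length (m k) = length \<mu>" "\<And>k. k \<le> N + 3 \<Longrightarrow> sum_list (m k) = k"
    and mono: "\<And>k l. k \<le> N \<Longrightarrow> l < length \<mu> \<Longrightarrow> m k ! l \<le> m (Suc k) ! l"
  shows "f p = scalar_prod (rec_vec \<mu> m f (N + 1)) (disk_P_vec \<mu> m (N + 1) p)
      + scalar_prod (rec_vec \<mu> m f N) (disk_P_vec \<mu> m N p)
      + (\<Sum>k = M - 1..<N. scalar_prod (rec_vec \<mu> m f k) (disk_P_vec \<mu> m k p))"
proof -
  define coef where "coef = (\<lambda>M' q i. pairing M' ((!) (jp_typeI M' \<mu> (m (Suc i)))) q)"
  define T where "T = (\<lambda>M' q i. coef M' q i * (poly (jp_typeII M' \<mu> (m i)) (sqnorm p) * Yharm \<eta>' M' p))"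
  have mono': "m i ! l \<le> m i' ! l" if "i \<le> i'" "i' \<le> N + 1" "l < length \<mu>" for i i' l
    using that
  proof (induction i' rule: dec_induct)
    case (step i')
    then show ?case using mono[of i' l] by simp
  qed simp
  have expand: "(\<Sum>i\<le>d. T M' q i) = poly q (sqnorm p) * Yharm \<eta>' M' p"
    if "d \<le> N + 1" "degree q \<le> d" for M' q d
  proof -
    have "q = (\<Sum>i\<le>d. smult (coef M' q i) (jp_typeII M' \<mu> (m i)))"
      unfolding coef_def
    proof (rule typeII_expansion)
      show "modulus ((!) (m i)) = i" if "i \<le> Suc d" for i
        using m[of i] that \<open>d \<le> N + 1\<close> by (simp add: modulus_nth)
      show "is_typeII M' ((!) (m i)) (jp_typeII M' \<mu> (m i))" if "i \<le> d" for i
        using m(1)[of i] that \<open>d \<le> N + 1\<close> by (intro is_typeII_jp_typeII) simp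
      show "is_typeI M' ((!) (m (Suc i))) ((!) (jp_typeI M' \<mu> (m (Suc i))))" if "i \<le> d" for i
        using m(1)[of "Suc i"] that \<open>d \<le> N + 1\<close> by (intro is_typeI_jp_typeI) simp
    qed (use mono' that in \<open>auto simp: coeff_eq_0\<close>)
    from arg_cong[OF this, of "\<lambda>s. poly s (sqnorm p)"]
    have "poly q (sqnorm p) = (\<Sum>i\<le>d. coef M' q i * poly (jp_typeII M' \<mu> (m i)) (sqnorm p))"
      by (simp only: poly_sum poly_smult)
    then show ?thesis by (simp add: T_def sum_distrib_right mult.assoc)
  qed
  have summand: "rec_coeff \<mu> m f k i \<eta> * disk_P \<mu> (m k) (m i) \<eta> p =
      (if \<eta>' = \<eta> \<and> k = 2 * i + (M + 1) then T (M + 1) q1 i else 0) +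
      (if \<eta>' = \<eta> \<and> k = 2 * i + (M - 1) then T (M - 1) q2 i else 0)"
    if k: "k \<le> N + 1" and i: "2 * i \<le> k" and \<eta>: "\<eta> \<in> {1, 2}" for k i \<eta>
  proof -
    have "sum_list (m k) - 2 * sum_list (m i) = k - 2 * i" using m(2)[of k] m(2)[of i] k i by simp
    then have P: "disk_P \<mu> (m k) (m i) \<eta> p =
        poly (jp_typeII (k - 2 * i) \<mu> (m i)) (sqnorm p) * Yharm \<eta> (k - 2 * i) p"
      by (simp only: disk_P_eq)
    have eqs: "M + 1 = k - 2 * i \<longleftrightarrow> k = 2 * i + (M + 1)" "M - 1 = k - 2 * i \<longleftrightarrow> k = 2 * i + (M - 1)"
      using i by auto
    show ?thesis
    proof (cases "\<eta> = 2 \<and> 2 * i = k")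
      \<comment> \<open>The sine block has no such entry; both sides vanish because the sine
        harmonic of degree 0 is 0.\<close>
      case True
      then have "Yharm \<eta> (k - 2 * i) p = 0" by (simp add: Yharm_2_0)
      then have "disk_P \<mu> (m k) (m i) \<eta> p = 0" by (simp only: P mult_zero_right)
      then show ?thesis using True by (auto simp: T_def Yharm_2_0)
    next
      case False
      have "rec_coeff \<mu> m f k i \<eta> =
          (if \<eta>' = \<eta> \<and> M + 1 = k - 2 * i then coef (M + 1) q1 i else 0) +
          (if \<eta>' = \<eta> \<and> M - 1 = k - 2 * i then coef (M - 1) q2 i else 0)"
        unfolding coef_def Suc_eq_plus1
        by (rule rec_coeff_eq[OF f]) (use False i k \<eta> \<eta>' m(2)[of "k + 2"] m(2)[of "i + 1"] in auto)
      then show ?thesis unfolding P eqs T_def by auto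
    qed
  qed
  have block: "scalar_prod (rec_vec \<mu> m f k) (disk_P_vec \<mu> m k p) =
      (\<Sum>i\<le>N + 1. (if k = 2 * i + (M + 1) then T (M + 1) q1 i else 0) +
        (if k = 2 * i + (M - 1) then T (M - 1) q2 i else 0))" if k: "k \<le> N + 1" for k
  proof -
    have "disk_P \<mu> (m k) (m i) 2 p = 0" if "2 * i = k" for i
      using m(2)[of k] m(2)[of i] k that by (simp add: disk_P_eq Yharm_2_0)
    then have "scalar_prod (rec_vec \<mu> m f k) (disk_P_vec \<mu> m k p) =
        (\<Sum>\<eta>\<in>{1, 2}. \<Sum>i | 2 * i \<le> k. rec_coeff \<mu> m f k i \<eta> * disk_P \<mu> (m k) (m i) \<eta> p)"
      unfolding rec_vec_def disk_P_vec_def by (rule scalar_prod_block_vec)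
    also have "\<dots> = (\<Sum>\<eta>\<in>{1, 2}. \<Sum>i | 2 * i \<le> k.
        (if \<eta>' = \<eta> \<and> k = 2 * i + (M + 1) then T (M + 1) q1 i else 0) +
        (if \<eta>' = \<eta> \<and> k = 2 * i + (M - 1) then T (M - 1) q2 i else 0))"
      by (intro sum.cong refl summand) (use k in auto)
    also have "\<dots> = (\<Sum>i | 2 * i \<le> k. (if k = 2 * i + (M + 1) then T (M + 1) q1 i else 0) +
        (if k = 2 * i + (M - 1) then T (M - 1) q2 i else 0))"
      using \<eta>' by auto
    \<comment> \<open>For \<open>2 * i > k\<close> both conditions fail, so the range can be made
      independent of \<open>k\<close>, which allows the exchange of sums.\<close>
    also have "\<dots> = (\<Sum>i\<le>N + 1. (if k = 2 * i + (M + 1) then T (M + 1) q1 i else 0) +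
        (if k = 2 * i + (M - 1) then T (M - 1) q2 i else 0))"
      using k by (intro sum.mono_neutral_left) auto
    finally show ?thesis .
  qed
  have range: "{M - 1..<N} \<union> {N, N + 1} = {M - 1..N + 1}" "{M - 1..<N} \<inter> {N, N + 1} = {}"
    unfolding M_def by auto
  have "scalar_prod (rec_vec \<mu> m f (N + 1)) (disk_P_vec \<mu> m (N + 1) p)
      + scalar_prod (rec_vec \<mu> m f N) (disk_P_vec \<mu> m N p)
      + (\<Sum>k = M - 1..<N. scalar_prod (rec_vec \<mu> m f k) (disk_P_vec \<mu> m k p)) =
      (\<Sum>k = M - 1..N + 1. scalar_prod (rec_vec \<mu> m f k) (disk_P_vec \<mu> m k p))"
    unfolding range(1)[symmetric] by (subst sum.union_disjoint) (auto simp: range(2))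
  also have "\<dots> = (\<Sum>k = M - 1..N + 1. \<Sum>i\<le>N + 1. (if k = 2 * i + (M + 1) then T (M + 1) q1 i else 0) +
        (if k = 2 * i + (M - 1) then T (M - 1) q2 i else 0))"
    by (intro sum.cong refl block) simp
  also have "\<dots> = (\<Sum>i\<le>N + 1. \<Sum>k = M - 1..N + 1. (if k = 2 * i + (M + 1) then T (M + 1) q1 i else 0) +
        (if k = 2 * i + (M - 1) then T (M - 1) q2 i else 0))"
    by (rule sum.swap)
  also have "\<dots> = (\<Sum>i\<le>N + 1. if i \<le> J then T (M + 1) q1 i else 0) +
      (\<Sum>i\<le>N + 1. if 2 * i + (M - 1) \<le> N + 1 then T (M - 1) q2 i else 0)"
    using J unfolding sum.distrib M_def
    by (intro arg_cong2[of _ _ _ _ "(+)"] sum.cong refl) auto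
  also have "(\<Sum>i\<le>N + 1. if i \<le> J then T (M + 1) q1 i else 0) = (\<Sum>i\<le>J. T (M + 1) q1 i)"
    using J by (intro sum.mono_neutral_cong_right) auto
  also have "(\<Sum>i\<le>N + 1. if 2 * i + (M - 1) \<le> N + 1 then T (M - 1) q2 i else 0) =
      (\<Sum>i\<le>J + 1. T (M - 1) q2 i)"
  proof (cases "M = 0")
    \<comment> \<open>Here \<open>M - 1\<close> is truncated to 0 and the condition would stop at
      \<open>i = J\<close>, but \<open>q2 = 0\<close> makes every term vanish.\<close>
    case True
    then have "T (M - 1) q2 i = 0" for i
      using pairing_smult[of 0 _ 0 0] q2(2) by (simp add: T_def coef_def)
    then show ?thesis by (simp cong: if_cong)
  next
    case False
    then show ?thesis using J unfolding M_def by (intro sum.mono_neutral_cong_right) auto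
  qed
  also have "(\<Sum>i\<le>J. T (M + 1) q1 i) + (\<Sum>i\<le>J + 1. T (M - 1) q2 i) = f p"
    unfolding f using expand[of J q1 "M + 1"] expand[of "J + 1" q2 "M - 1"] J q1 q2(1) by simp
  finally show ?thesis by (rule sym)
qed

end

text \<open>With \<open>z = x + \<i> * y\<close> one has \<open>x = (z + cnj z) / 2\<close>,
  \<open>y = (z - cnj z) / (2 * \<i>)\<close> and \<open>z * cnj z = sqnorm p\<close>. The equations
  are real and imaginary parts of the resulting multiples of \<open>z ^ Suc M\<close>, with a radial
  factor \<open>c\<close>.\<close>

lemma mult_Yharm_Suc:
  "fst p * (c * Yharm 1 (Suc M) p) =
    1 / 2 * c * Yharm 1 (Suc M + 1) p + sqnorm p * c / 2 * Yharm 1 M p"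
  "fst p * (c * Yharm 2 (Suc M) p) =
    1 / 2 * c * Yharm 2 (Suc M + 1) p + sqnorm p * c / 2 * Yharm 2 M p"
  "snd p * (c * Yharm 1 (Suc M) p) =
    1 / 2 * c * Yharm 2 (Suc M + 1) p + - (sqnorm p * c / 2) * Yharm 2 M p"
  "snd p * (c * Yharm 2 (Suc M) p) =
    - 1 / 2 * c * Yharm 1 (Suc M + 1) p + sqnorm p * c / 2 * Yharm 1 M p"
  by (simp_all add: Yharm_eq cpoint_def sqnorm_def power2_eq_square field_simps)

lemma mult_Yharm_0: "fst p * Yharm 1 0 p = Yharm 1 1 p" "snd p * Yharm 1 0 p = Yharm 2 1 p"
  by (simp_all add: Yharm_eq cpoint_def)

text \<open>The indices reach modulus \<open>sum_list n + 3\<close> because the coefficients with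
  \<open>k = sum_list n + 1\<close> have such an upper index, of which \<open>disk_Q\<close> reads
  only the modulus. Truncated subtraction starts the sum at 0 if
  \<open>sum_list n = 2 * sum_list j\<close>. The identities hold on the whole plane, as the radial
  expansions are identities of polynomials.\<close>

theorem theorem18:
  fixes r :: nat and \<mu> :: "real list"
    and n j :: "nat list" and \<nu> l :: nat and m :: "nat \<Rightarrow> nat list"
  assumes "length \<mu> = r" and "length n = r" and "length j = r"
    and "\<forall>i<r. \<mu> ! i > -1"
    and "\<forall>i<r. \<forall>i'<r. i \<noteq> i' \<longrightarrow> \<mu> ! i - \<mu> ! i' \<notin> \<int>"
    and "2 * sum_list j \<le> sum_list n"
    and "\<nu> \<in> {1, 2}" and "\<nu> = 2 \<longrightarrow> 2 * sum_list j < sum_list n"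
    and "\<forall>k\<le>sum_list n + 3. length (m k) = r \<and> sum_list (m k) = k"
    and "\<forall>k<sum_list n. neighbours (m k) (m (Suc k))"
    and "m 0 = replicate r 0" and "m (sum_list n) = n"
    and "l < r" and "m (sum_list n + 1) = plus_unit n l"
  shows "(\<forall>p. fst p * disk_P \<mu> n j \<nu> p =
             (let c = rec_vec \<mu> m (\<lambda>q. fst q * disk_P \<mu> n j \<nu> q) in
               scalar_prod (c (sum_list n + 1)) (disk_P_vec \<mu> m (sum_list n + 1) p)
             + scalar_prod (c (sum_list n)) (disk_P_vec \<mu> m (sum_list n) p)
             + (\<Sum>k = sum_list n - 2 * sum_list j - 1..<sum_list n.
                  scalar_prod (c k) (disk_P_vec \<mu> m k p))))
       \<and> (\<forall>p. snd p * disk_P \<mu> n j \<nu> p =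
             (let c = rec_vec \<mu> m (\<lambda>q. snd q * disk_P \<mu> n j \<nu> q) in
               scalar_prod (c (sum_list n + 1)) (disk_P_vec \<mu> m (sum_list n + 1) p)
             + scalar_prod (c (sum_list n)) (disk_P_vec \<mu> m (sum_list n) p)
             + (\<Sum>k = sum_list n - 2 * sum_list j - 1..<sum_list n.
                  scalar_prod (c k) (disk_P_vec \<mu> m k p))))"
proof -
  interpret disk_weights \<mu> by unfold_locales (use assms in auto)
  define N J M where "N = sum_list n" and "J = sum_list j" and "M = N - 2 * J"
  define P where "P = jp_typeII M \<mu> j"
  have P: "disk_P \<mu> n j \<nu> p = poly P (sqnorm p) * Yharm \<nu> M p" for p
    unfolding disk_P_eq P_def M_def N_def J_def ..
  have j: "length j = length \<mu>" using assms(1,3) by simp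
  have deg: "degree P \<le> J"
    using is_typeII_jp_typeII[OF j, of M] modulus_nth[OF j] unfolding is_typeII_def P_def J_def by simp
  \<comment> \<open>Inside the path this follows from neighbours of increasing modulus, at its end
    from the added unit vector.\<close>
  have mono: "m k ! i \<le> m (Suc k) ! i" if "k \<le> N" "i < length \<mu>" for k i
  proof (cases "k = N")
    case True
    then show ?thesis using assms(1,2,12,14) that plus_unit_nth_le[of i n l] by (simp add: N_def)
  next
    case False
    then show ?thesis
      using assms(1,9,10) that by (intro neighbours_nth_le) (auto simp: N_def)
  qed
  have main: "\<forall>p. f p = (let c = rec_vec \<mu> m f in
      scalar_prod (c (N + 1)) (disk_P_vec \<mu> m (N + 1) p) + scalar_prod (c N) (disk_P_vec \<mu> m N p)
      + (\<Sum>k = N - 2 * J - 1..<N. scalar_prod (c k) (disk_P_vec \<mu> m k p)))"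
    if "\<eta>' \<in> {1, 2}" "degree q1 \<le> J" "degree q2 \<le> J + 1" "M = 0 \<longrightarrow> q2 = 0"
      and "\<forall>p. f p = poly q1 (sqnorm p) * Yharm \<eta>' (M + 1) p + poly q2 (sqnorm p) * Yharm \<eta>' (M - 1) p"
    for f \<eta>' q1 q2
    unfolding Let_def
    by (intro allI recurrence[of J N \<eta>' f q1 q2])
       (use that assms(1,6,9) mono in \<open>auto simp: M_def N_def J_def\<close>)
  \<comment> \<open>Radial factor of the harmonic of lower degree: half of \<open>z * cnj z\<close>
    times \<open>P\<close>.\<close>
  define X where "X = [:0, 1 / 2:] * P"
  have X: "degree X \<le> J + 1" "degree (- X) \<le> J + 1" "poly X t = t * poly P t / 2" for t
    using deg degree_mult_le[of "[:0, 1 / 2:]" P] by (simp_all add: X_def)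
  have half: "degree (smult a P) \<le> J" for a using degree_smult_le deg by (rule order_trans)
  note simps = P mult_Yharm_Suc X(3) poly_smult poly_minus diff_Suc_1
  have "(\<forall>p. fst p * disk_P \<mu> n j \<nu> p = (let c = rec_vec \<mu> m (\<lambda>q. fst q * disk_P \<mu> n j \<nu> q) in
      scalar_prod (c (N + 1)) (disk_P_vec \<mu> m (N + 1) p) + scalar_prod (c N) (disk_P_vec \<mu> m N p)
      + (\<Sum>k = N - 2 * J - 1..<N. scalar_prod (c k) (disk_P_vec \<mu> m k p))))"
  proof (cases M)
    \<comment> \<open>The sine case is excluded by \<open>M = 0\<close>, and the constant harmonic
      times a coordinate has no part of lower degree, so \<open>q2 = 0\<close>.\<close>
    case 0
    then have "\<nu> = 1" using assms(6-8) by (auto simp: M_def N_def J_def)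
    then have "\<forall>p. fst p * disk_P \<mu> n j \<nu> p =
        poly P (sqnorm p) * Yharm 1 (M + 1) p + poly 0 (sqnorm p) * Yharm 1 (M - 1) p"
      unfolding P 0 by (simp add: mult.left_commute mult_Yharm_0[simplified])
    then show ?thesis using deg by (intro main[of 1 P 0]) simp_all
  next
    case (Suc M')
    have "\<forall>p. fst p * disk_P \<mu> n j \<nu> p =
        poly (smult (1 / 2) P) (sqnorm p) * Yharm \<nu> (M + 1) p + poly X (sqnorm p) * Yharm \<nu> (M - 1) p"
      using assms(7) unfolding P Suc by (elim insertE emptyE) (simp_all only: simps simp_thms)
    then show ?thesis using assms(7) Suc
      by (intro main[of \<nu> "smult (1 / 2) P" X, OF _ half X(1)]) simp_all
  qed
  moreover have "(\<forall>p. snd p * disk_P \<mu> n j \<nu> p = (let c = rec_vec \<mu> m (\<lambda>q. snd q * disk_P \<mu> n j \<nu> q) in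
      scalar_prod (c (N + 1)) (disk_P_vec \<mu> m (N + 1) p) + scalar_prod (c N) (disk_P_vec \<mu> m N p)
      + (\<Sum>k = N - 2 * J - 1..<N. scalar_prod (c k) (disk_P_vec \<mu> m k p))))"
  proof (cases M)
    case 0
    then have "\<nu> = 1" using assms(6-8) by (auto simp: M_def N_def J_def)
    then have "\<forall>p. snd p * disk_P \<mu> n j \<nu> p =
        poly P (sqnorm p) * Yharm 2 (M + 1) p + poly 0 (sqnorm p) * Yharm 2 (M - 1) p"
      unfolding P 0 by (simp add: mult.left_commute mult_Yharm_0[simplified])
    then show ?thesis using deg by (intro main[of 2 P 0]) simp_all
  next
    case (Suc M')
    \<comment> \<open>Multiplication by \<open>y\<close> exchanges cosine and sine harmonics, with
      signs that depend on \<open>\<nu>\<close>.\<close>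
    consider "\<nu> = 1" | "\<nu> = 2" using assms(7) by auto
    then show ?thesis
    proof cases
      case 1
      have "\<forall>p. snd p * disk_P \<mu> n j \<nu> p =
          poly (smult (1 / 2) P) (sqnorm p) * Yharm 2 (M + 1) p + poly (- X) (sqnorm p) * Yharm 2 (M - 1) p"
        unfolding 1 P[unfolded 1] Suc by (simp only: simps simp_thms)
      then show ?thesis using Suc
        by (intro main[of 2 "smult (1 / 2) P" "- X", OF _ half X(2)]) simp_all
    next
      case 2
      have "\<forall>p. snd p * disk_P \<mu> n j \<nu> p =
          poly (smult (- 1 / 2) P) (sqnorm p) * Yharm 1 (M + 1) p + poly X (sqnorm p) * Yharm 1 (M - 1) p"
        unfolding 2 P[unfolded 2] Suc by (simp only: simps simp_thms)
      then show ?thesis using Suc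
        by (intro main[of 1 "smult (- 1 / 2) P" X, OF _ half X(1)]) simp_all
    qed
  qed
  ultimately show ?thesis unfolding N_def J_def by blast
qed

end
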